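(* Let $(M^5,g,\xi,\eta,\varphi)$ be a $5$-dimensional almost contact metric manifold. Then the following hold. If $(M^5,g,\xi,\eta,\varphi)$ is of class - $\mathcal{W}_1\oplus\mathcal{W}_3\oplus\mathcal{W}_5\oplus\mathcal{W}_6\oplus\mathcal{W}_8$, then it is normal; - $\mathcal{W}_9\oplus\mathcal{W}_{10}$, then it is quasi-cosymplectic and almost cosymplectic; - $\mathcal{W}_4\oplus\mathcal{W}_5\oplus\mathcal{W}_7\oplus\mathcal{W}_8\oplus\mathcal{W}_9\oplus\mathcal{W}_{10}$, then it is semi-cosymplectic; - $\mathcal{W}_3\oplus\mathcal{W}_5$, then it is quasi-Sasaki; - $\mathcal{W}_1\oplus\mathcal{W}_3$, then it is trans-Sasaki.
   Context: Local model. $\mathbb{R}^5$ is Euclidean space with scalar product $\langle\cdot,\cdot\rangle$, an orientation and an oriented orthonormal basis $(e_1,\dots,e_5)$; vectors and $1$-forms are identified via $\langle\cdot,\cdot\rangle$; $\Lambda^k$ is the space of $k$-forms on $\mathbb{R}^5$, $*$ the Hodge operator, $\lrcorner$ the interior product, and $(e_1\wedge e_2)(e_1,e_2)=1$. Put $\xi=e_5$, $\eta$ its dual $1$-form, $\varphi$ the endomorphism with $\varphi(e_1)=-e_2$, $\varphi(e_2)=e_1$, $\varphi(e_3)=-e_4$, $\varphi(e_4)=e_3$, $\varphi(\xi)=0$, and $\Phi(X,Y)=\langle X,\varphi(Y)\rangle$, so $\Phi=e_1\wedge e_2+e_3\wedge e_4$. $U(2)=\{B\in O(5): B\xi=\xi,\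 B\circ\varphi=\varphi\circ B\}$. Subspaces of forms: $\Lambda^1_1=\mathbb{R}\eta$, $\Lambda^1_2=\{\alpha\in\Lambda^1:\xi\lrcorner\alpha=0\}$; $\Lambda^2_1=\mathbb{R}\Phi$, $\Lambda^2_2=\{\alpha\in\Lambda^2:\Phi\wedge\alpha=0,\ *\alpha=\eta\wedge\alpha\}$, $\Lambda^2_3=\{\alpha\in\Lambda^2:*\alpha=-\eta\wedge\alpha\}$, $\Lambda^2_4=\{\alpha\in\Lambda^2:\eta\wedge\alpha=0\}$; $\Lambda^3_i=*\Lambda^2_i$. Identifying $\mathfrak{so}(5)=\Lambda^2$, $\mathfrak{u}(2)=\Lambda^2_1\oplus\Lambda^2_3$ has orthogonal complement $\mathfrak{m}=\Lambda^2_2\oplus\Lambda^2_4$; $\operatorname{pr}_{\mathfrak m}:\Lambda^2\to\mathfrak{m}$ is the orthogonal projection. $\mathcal{A}=\Lambda^1\otimes\Lambda^2=\{A\in\otimes^3\Lambda^1: A(X,Y,Z)+A(X,Z,Y)=0\}$, where $(\alpha\otimes\beta)(X,Y,Z)=\alpha(X)\beta(Y,Z)$; $\mathcal{A}_3=\{A\in\mathcal{A}: A(X,Y,Z)+A(Y,Z,X)+A(Z,X,Y)=0,\ \sum_iA(e_i,e_i,X)=0\}$; $\mathcal{W}=\Lambda^1\otimes\mathfrak{m}$ and $\operatorname{pr}_{\mathcal W}:\mathcal{A}\to\mathcal{W}$, $\operatorname{pr}_{\mathcal W}(\alpha\otimes\beta)=\alpha\otimes\operatorname{pr}_{\mathfrak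 m}(\beta)$. Put $\theta_1(\alpha)(X,Y,Z)=\alpha(Z)\langle X,Y\rangle-\alpha(Y)\langle X,Z\rangle$ for $\alpha\in\Lambda^1$; $\theta_2(\alpha)=\sum_ie_i\otimes(e_i\lrcorner\alpha)$ for $\alpha\in\Lambda^3$; $\theta_3(\alpha)=3\,\eta\otimes\alpha-\theta_2(\eta\wedge\alpha)$ for $\alpha\in\Lambda^2_1\oplus\Lambda^2_2\oplus\Lambda^2_3$. Then $\mathcal{W}=\mathcal{W}_1\oplus\dots\oplus\mathcal{W}_{10}$ ($U(2)$-irreducible summands) with $\mathcal{W}_1=\theta_1(\Lambda^1_1)$, $\mathcal{W}_2=\operatorname{pr}_{\mathcal W}(\theta_1(\Lambda^1_2))$, $\mathcal{W}_3=\operatorname{pr}_{\mathcal W}(\theta_2(\Lambda^3_1))$, $\mathcal{W}_4=\theta_2(\Lambda^3_2)$, $\mathcal{W}_5=\operatorname{pr}_{\mathcal W}(\theta_2(\Lambda^3_3))$, $\mathcal{W}_6=\operatorname{pr}_{\mathcal W}(\theta_2(\Lambda^3_4))$, $\mathcal{W}_7=\theta_3(\Lambda^2_2)$, $\mathcal{W}_8=\{A\in\mathcal{A}_3:A(X,Y,Z)=A(\varphi X,Y,\varphi Z)+A(\varphi X,\varphi Y,Z)\}$, $\mathcal{W}_9=\{A\in\mathcal{A}_3:A(X,Y,Z)=-A(X,\varphi Y,\varphi Z)\}$, $\mathcal{W}_{10}=\{A\in\mathcal{A}_3:A(X,Y,Z)=-A(\varphi X,Y,\varphi Z)-A(\varphi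 X,\varphi Y,Z)\}$. Manifolds. An almost contact metric $5$-manifold $(M^5,g,\xi,\eta,\varphi)$ is a Riemannian $5$-manifold with a unit vector field $\xi$, its dual $1$-form $\eta$ and an endomorphism $\varphi$ of $TM^5$ with $\varphi(\xi)=0$, $\varphi^2=-\mathrm{Id}+\eta\otimes\xi$, $g(\varphi X,\varphi Y)=g(X,Y)-\eta(X)\eta(Y)$. Its fundamental form is $\Phi(X,Y)=g(X,\varphi(Y))$. Locally there are adapted frames: oriented orthonormal frames $(e_1,\dots,e_5)$ with $\xi=e_5$, $\Phi=e_1\wedge e_2+e_3\wedge e_4$, which identify each tangent space with the local model (all subspaces above are $U(2)$-invariant, hence define subbundles). With $\nabla^g$ the Levi-Civita connection and $\omega^g_{ij}=g(\nabla^ge_i,e_j)$, put $\Omega^g(X)=\sum_{i<j}\omega^g_{ij}(X)\,e_i\wedge e_j$. The intrinsic torsion is $\Gamma=\operatorname{pr}_{\mathfrak m}(\Omega^g)$, a section of $\mathcal{W}$. The manifold is of class $\mathcal{W}_{i_1}\oplus\dots\oplus\mathcal{W}_{i_k}$ if $\Gamma\in\mathcal{W}_{i_1}\oplus\dots\oplus\mathcal{W}_{i_k}$. For forms, $d\alpha=\sum_ie_i\wedge\nabla^g_{e_i}\alpha$, $\delta\alpha=-\sum_ie_i\lrcorner\nabla^g_{e_i}\alpha$. The Nijenhuis tensor is $N(X,Y)=[\varphi X,\varphi Y]+\varphi^2([X,Y])-\varphi([\varphi X,Y])-\varphi([X,\varphi Y])+d\eta(X,Y)\,\xi$. Special types.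 The manifold is: normal if $N=0$; almost cosymplectic if $d\Phi=0$ and $d\eta=0$; semi-cosymplectic if $\delta\Phi=0$ and $\delta\eta=0$; quasi-cosymplectic if $(\nabla^g_X\varphi)(Y)+(\nabla^g_{\varphi(X)}\varphi)(\varphi(Y))=\eta(Y)\nabla^g_{\varphi(X)}\xi$; quasi-Sasaki if it is normal and $d\Phi=0$; trans-Sasaki if $4(\nabla^g_X\Phi)(Y,Z)=g(X,\delta\Phi(\xi)Z+\delta\eta\,\varphi(Z))\eta(Y)-g(X,\delta\Phi(\xi)Y+\delta\eta\,\varphi(Y))\eta(Z)$. *)

theory Defs
  imports "HOL-Analysis.Analysis"
begin

section \<open>The local model\<close>

type_synonym vec5 = "real^5"
type_synonym form1 = "vec5 \<Rightarrow> real"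
type_synonym form2 = "vec5 \<Rightarrow> vec5 \<Rightarrow> real"
type_synonym form3 = "vec5 \<Rightarrow> vec5 \<Rightarrow> vec5 \<Rightarrow> real"
type_synonym form4 = "vec5 \<Rightarrow> vec5 \<Rightarrow> vec5 \<Rightarrow> vec5 \<Rightarrow> real"
type_synonym tensor3 = "vec5 \<Rightarrow> vec5 \<Rightarrow> vec5 \<Rightarrow> real"

text \<open>The indices of the type \<^typ>\<open>5\<close> are \<open>1, 2, 3, 4, 5\<close>, where \<open>5 = 0\<close>, so that the
  order of the type is \<open>5 < 1 < 2 < 3 < 4\<close>. This is harmless: each sum over \<open>i < j\<close> below
  has a summand that is symmetric in \<open>i\<close> and \<open>j\<close>, so it is the sum over unordered pairs.\<close>

definition e :: "5 \<Rightarrow> vec5" where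
  "e i = axis i 1"

definition dual :: "vec5 \<Rightarrow> form1" where
  "dual a = (\<lambda>X. a \<bullet> X)"

definition xi0 :: vec5 where
  "xi0 = e 5"

definition eta0 :: form1 where
  "eta0 = dual xi0"

text \<open>The linear map with \<open>e\<^sub>1 \<mapsto> - e\<^sub>2\<close>, \<open>e\<^sub>2 \<mapsto> e\<^sub>1\<close>, \<open>e\<^sub>3 \<mapsto> - e\<^sub>4\<close>, \<open>e\<^sub>4 \<mapsto> e\<^sub>3\<close>, \<open>e\<^sub>5 \<mapsto> 0\<close>.\<close>

definition phi0 :: "vec5 \<Rightarrow> vec5" where
  "phi0 X = X $ 1 *\<^sub>R (- e 2) + X $ 2 *\<^sub>R e 1 + X $ 3 *\<^sub>R (- e 4) + X $ 4 *\<^sub>R e 3"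

definition Phi0 :: form2 where
  "Phi0 X Y = X \<bullet> phi0 Y"

definition Lam1 :: "form1 set" where
  "Lam1 = {\<alpha>. linear \<alpha>}"

definition Lam2 :: "form2 set" where
  "Lam2 = {\<alpha>. bilinear \<alpha> \<and> (\<forall>X Y. \<alpha> X Y = - \<alpha> Y X)}"

text \<open>Wedge products, indexed by the degrees of the factors and normalised by
  \<open>(e\<^sub>1 \<and> e\<^sub>2)(e\<^sub>1, e\<^sub>2) = 1\<close> (sums over shuffles).\<close>

definition wedge11 :: "form1 \<Rightarrow> form1 \<Rightarrow> form2" where
  "wedge11 \<alpha> \<beta> X Y = \<alpha> X * \<beta> Y - \<alpha> Y * \<beta> X"

definition wedge12 :: "form1 \<Rightarrow> form2 \<Rightarrow> form3" where
  "wedge12 \<alpha> \<beta> X Y Z = \<alpha> X * \<beta> Y Z - \<alpha> Y * \<beta> X Z + \<alpha> Z * \<beta> X Y"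

definition wedge22 :: "form2 \<Rightarrow> form2 \<Rightarrow> form4" where
  "wedge22 \<alpha> \<beta> X Y Z T =
     \<alpha> X Y * \<beta> Z T - \<alpha> X Z * \<beta> Y T + \<alpha> X T * \<beta> Y Z
     + \<alpha> Y Z * \<beta> X T - \<alpha> Y T * \<beta> X Z + \<alpha> Z T * \<beta> X Y"

definition vol :: "vec5 \<Rightarrow> vec5 \<Rightarrow> vec5 \<Rightarrow> vec5 \<Rightarrow> vec5 \<Rightarrow> real" where
  "vol X1 X2 X3 X4 X5 = det (vector [X1, X2, X3, X4, X5] :: real^5^5)"

text \<open>The Hodge operator from 2-forms to 3-forms; e.g. \<open>* (e\<^sub>1 \<and> e\<^sub>2) = e\<^sub>3 \<and> e\<^sub>4 \<and> e\<^sub>5\<close>.\<close>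

definition hodge2 :: "form2 \<Rightarrow> form3" where
  "hodge2 \<alpha> X Y Z = (\<Sum>(i, j) | i < j. \<alpha> (e i) (e j) * vol (e i) (e j) X Y Z)"

definition inner2 :: "form2 \<Rightarrow> form2 \<Rightarrow> real" where
  "inner2 \<alpha> \<beta> = (\<Sum>(i, j) | i < j. \<alpha> (e i) (e j) * \<beta> (e i) (e j))"

definition Lam1_1 :: "form1 set" where
  "Lam1_1 = {\<lambda>X. t * eta0 X | t. True}"

definition Lam1_2 :: "form1 set" where
  "Lam1_2 = {\<alpha> \<in> Lam1. \<alpha> xi0 = 0}"

definition Lam2_1 :: "form2 set" where
  "Lam2_1 = {\<lambda>X Y. t * Phi0 X Y | t. True}"

definition Lam2_2 :: "form2 set" where
  "Lam2_2 = {\<alpha> \<in> Lam2. wedge22 Phi0 \<alpha> = (\<lambda>X Y Z T. 0) \<and> hodge2 \<alpha> = wedge12 eta0 \<alpha>}"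

definition Lam2_3 :: "form2 set" where
  "Lam2_3 = {\<alpha> \<in> Lam2. hodge2 \<alpha> = (\<lambda>X Y Z. - wedge12 eta0 \<alpha> X Y Z)}"

definition Lam2_4 :: "form2 set" where
  "Lam2_4 = {\<alpha> \<in> Lam2. wedge12 eta0 \<alpha> = (\<lambda>X Y Z. 0)}"

definition Lam3_1 :: "form3 set" where "Lam3_1 = hodge2 ` Lam2_1"
definition Lam3_2 :: "form3 set" where "Lam3_2 = hodge2 ` Lam2_2"
definition Lam3_3 :: "form3 set" where "Lam3_3 = hodge2 ` Lam2_3"
definition Lam3_4 :: "form3 set" where "Lam3_4 = hodge2 ` Lam2_4"

text \<open>The orthogonal complement of \<open>u(2) = Lam2_1 \<oplus> Lam2_3\<close> in \<open>so(5) = Lam2\<close>, and the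
  orthogonal projection onto it.\<close>

definition m_space :: "form2 set" where
  "m_space = {\<lambda>X Y. \<alpha> X Y + \<beta> X Y | \<alpha> \<beta>. \<alpha> \<in> Lam2_2 \<and> \<beta> \<in> Lam2_4}"

definition pr_m :: "form2 \<Rightarrow> form2" where
  "pr_m \<alpha> = (THE \<beta>. \<beta> \<in> m_space \<and> (\<forall>\<gamma>\<in>m_space. inner2 (\<lambda>X Y. \<alpha> X Y - \<beta> X Y) \<gamma> = 0))"

definition A_space :: "tensor3 set" where
  "A_space = {A. (\<forall>Y Z. linear (\<lambda>X. A X Y Z)) \<and> (\<forall>X. bilinear (A X)) \<and>
                 (\<forall>X Y Z. A X Y Z + A X Z Y = 0)}"

definition A3_space :: "tensor3 set" where
  "A3_space = {A \<in> A_space. (\<forall>X Y Z. A X Y Z + A Y Z X + A Z X Y = 0) \<and>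
                             (\<forall>X. (\<Sum>i\<in>UNIV. A (e i) (e i) X) = 0)}"

text \<open>The linear map with \<open>\<alpha> \<otimes> \<beta> \<mapsto> \<alpha> \<otimes> pr_m \<beta>\<close>: the projection is applied to the 2-form
  \<open>A X\<close> for each \<open>X\<close>.\<close>

definition pr_W :: "tensor3 \<Rightarrow> tensor3" where
  "pr_W A = (\<lambda>X. pr_m (A X))"

definition theta1 :: "form1 \<Rightarrow> tensor3" where
  "theta1 \<alpha> X Y Z = \<alpha> Z * (X \<bullet> Y) - \<alpha> Y * (X \<bullet> Z)"

definition theta2 :: "form3 \<Rightarrow> tensor3" where
  "theta2 \<alpha> X Y Z = (\<Sum>i\<in>UNIV. dual (e i) X * \<alpha> (e i) Y Z)"

definition theta3 :: "form2 \<Rightarrow> tensor3" where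
  "theta3 \<alpha> X Y Z = 3 * (eta0 X * \<alpha> Y Z) - theta2 (wedge12 eta0 \<alpha>) X Y Z"

definition W1 :: "tensor3 set" where "W1 = theta1 ` Lam1_1"
definition W2 :: "tensor3 set" where "W2 = (\<lambda>\<alpha>. pr_W (theta1 \<alpha>)) ` Lam1_2"
definition W3 :: "tensor3 set" where "W3 = (\<lambda>\<alpha>. pr_W (theta2 \<alpha>)) ` Lam3_1"
definition W4 :: "tensor3 set" where "W4 = theta2 ` Lam3_2"
definition W5 :: "tensor3 set" where "W5 = (\<lambda>\<alpha>. pr_W (theta2 \<alpha>)) ` Lam3_3"
definition W6 :: "tensor3 set" where "W6 = (\<lambda>\<alpha>. pr_W (theta2 \<alpha>)) ` Lam3_4"
definition W7 :: "tensor3 set" where "W7 = theta3 ` Lam2_2"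

definition W8 :: "tensor3 set" where
  "W8 = {A \<in> A3_space. \<forall>X Y Z. A X Y Z = A (phi0 X) Y (phi0 Z) + A (phi0 X) (phi0 Y) Z}"

definition W9 :: "tensor3 set" where
  "W9 = {A \<in> A3_space. \<forall>X Y Z. A X Y Z = - A X (phi0 Y) (phi0 Z)}"

definition W10 :: "tensor3 set" where
  "W10 = {A \<in> A3_space. \<forall>X Y Z. A X Y Z = - A (phi0 X) Y (phi0 Z) - A (phi0 X) (phi0 Y) Z}"

definition W :: "nat \<Rightarrow> tensor3 set" where
  "W i = [W1, W2, W3, W4, W5, W6, W7, W8, W9, W10] ! (i - 1)"

definition W_sum :: "nat set \<Rightarrow> tensor3 set" where
  "W_sum I = {A. \<exists>B. (\<forall>i\<in>I. B i \<in> W i) \<and> A = (\<lambda>X Y Z. \<Sum>i\<in>I. B i X Y Z)}"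


section \<open>Smooth 5-manifolds and tensor fields\<close>

text \<open>\<open>C\<^sup>k\<close> and smooth maps on an open set \<open>S\<close>.\<close>

primrec Ck_on :: "nat \<Rightarrow> 'a::euclidean_space set \<Rightarrow> ('a \<Rightarrow> 'b::real_normed_vector) \<Rightarrow> bool" where
  "Ck_on 0 S f \<longleftrightarrow> continuous_on S f"
| "Ck_on (Suc k) S f \<longleftrightarrow>
     f differentiable_on S \<and> (\<forall>v. Ck_on k S (\<lambda>x. frechet_derivative f (at x) v))"

definition smooth_on :: "'a::euclidean_space set \<Rightarrow> ('a \<Rightarrow> 'b::real_normed_vector) \<Rightarrow> bool" where
  "smooth_on S f \<longleftrightarrow> (\<forall>k. Ck_on k S f)"

type_synonym 'm chart = "'m set \<times> ('m \<Rightarrow> vec5)"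

definition chart_image :: "'m chart \<Rightarrow> vec5 set" where
  "chart_image c = snd c ` fst c"

definition transition :: "'m chart \<Rightarrow> 'm chart \<Rightarrow> vec5 \<Rightarrow> vec5" where
  "transition c d = snd d \<circ> inv_into (fst c) (snd c)"

text \<open>The manifold is the whole Hausdorff, second countable space \<open>'m\<close>.\<close>

definition smooth_atlas :: "'m::{t2_space,second_countable_topology} chart set \<Rightarrow> bool" where
  "smooth_atlas \<A> \<longleftrightarrow>
     (\<forall>c\<in>\<A>. open (fst c) \<and> open (chart_image c) \<and>
        (\<exists>h. homeomorphism (fst c) (chart_image c) (snd c) h)) \<and>
     (\<Union>c\<in>\<A>. fst c) = UNIV \<and>
     (\<forall>c\<in>\<A>. \<forall>d\<in>\<A>. smooth_on (snd c ` (fst c \<inter> fst d)) (transition c d))"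

text \<open>A tensor field is the family, indexed by the charts of the atlas, of its coordinate
  expressions: functions of the coordinate point \<open>x \<in> chart_image c\<close> with values in the
  corresponding tensors of \<^typ>\<open>vec5\<close> (components in the coordinate basis of the tangent space),
  subject to the tensorial transformation law under change of charts.\<close>

type_synonym metric = "vec5 \<Rightarrow> vec5 \<Rightarrow> vec5 \<Rightarrow> real"
type_synonym vfield = "vec5 \<Rightarrow> vec5"
type_synonym field1 = "vec5 \<Rightarrow> form1"
type_synonym field2 = "vec5 \<Rightarrow> form2"
type_synonym endo = "vec5 \<Rightarrow> vec5 \<Rightarrow> vec5"

definition compatible ::
    "'m chart set \<Rightarrow> ('m chart \<Rightarrow> 'm chart \<Rightarrow> vec5 \<Rightarrow> vec5 \<Rightarrow> (vec5 \<Rightarrow> vec5) \<Rightarrow> bool) \<Rightarrow> bool" where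
  "compatible \<A> P \<longleftrightarrow>
     (\<forall>c\<in>\<A>. \<forall>d\<in>\<A>. \<forall>p \<in> fst c \<inter> fst d.
        P c d (snd c p) (snd d p) (frechet_derivative (transition c d) (at (snd c p))))"

definition riemannian_metric :: "'m chart set \<Rightarrow> ('m chart \<Rightarrow> metric) \<Rightarrow> bool" where
  "riemannian_metric \<A> g \<longleftrightarrow>
     (\<forall>c\<in>\<A>. (\<forall>u v. smooth_on (chart_image c) (\<lambda>x. g c x u v)) \<and>
        (\<forall>x\<in>chart_image c. bilinear (g c x) \<and> (\<forall>u v. g c x u v = g c x v u) \<and>
           (\<forall>u. u \<noteq> 0 \<longrightarrow> g c x u u > 0))) \<and>
     compatible \<A> (\<lambda>c d x y J. \<forall>u v. g c x u v = g d y (J u) (J v))"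

definition vector_field :: "'m chart set \<Rightarrow> ('m chart \<Rightarrow> vfield) \<Rightarrow> bool" where
  "vector_field \<A> X \<longleftrightarrow>
     (\<forall>c\<in>\<A>. smooth_on (chart_image c) (X c)) \<and>
     compatible \<A> (\<lambda>c d x y J. X d y = J (X c x))"

definition one_form :: "'m chart set \<Rightarrow> ('m chart \<Rightarrow> field1) \<Rightarrow> bool" where
  "one_form \<A> \<alpha> \<longleftrightarrow>
     (\<forall>c\<in>\<A>. (\<forall>v. smooth_on (chart_image c) (\<lambda>x. \<alpha> c x v)) \<and>
        (\<forall>x\<in>chart_image c. linear (\<alpha> c x))) \<and>
     compatible \<A> (\<lambda>c d x y J. \<forall>v. \<alpha> c x v = \<alpha> d y (J v))"

definition endomorphism_field :: "'m chart set \<Rightarrow> ('m chart \<Rightarrow> endo) \<Rightarrow> bool" where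
  "endomorphism_field \<A> \<phi> \<longleftrightarrow>
     (\<forall>c\<in>\<A>. (\<forall>v. smooth_on (chart_image c) (\<lambda>x. \<phi> c x v)) \<and>
        (\<forall>x\<in>chart_image c. linear (\<phi> c x))) \<and>
     compatible \<A> (\<lambda>c d x y J. \<forall>v. \<phi> d y (J v) = J (\<phi> c x v))"

definition almost_contact_metric ::
    "'m::{t2_space,second_countable_topology} chart set \<Rightarrow> ('m chart \<Rightarrow> metric) \<Rightarrow> ('m chart \<Rightarrow> vfield) \<Rightarrow>
     ('m chart \<Rightarrow> field1) \<Rightarrow> ('m chart \<Rightarrow> endo) \<Rightarrow> bool" where
  "almost_contact_metric \<A> g \<xi> \<eta> \<phi> \<longleftrightarrow>
     smooth_atlas \<A> \<and> riemannian_metric \<A> g \<and> vector_field \<A> \<xi> \<and>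
     one_form \<A> \<eta> \<and> endomorphism_field \<A> \<phi> \<and>
     (\<forall>c\<in>\<A>. \<forall>x\<in>chart_image c.
        g c x (\<xi> c x) (\<xi> c x) = 1 \<and>
        (\<forall>v. \<eta> c x v = g c x (\<xi> c x) v) \<and>
        \<phi> c x (\<xi> c x) = 0 \<and>
        (\<forall>v. \<phi> c x (\<phi> c x v) = - v + \<eta> c x v *\<^sub>R \<xi> c x) \<and>
        (\<forall>u v. g c x (\<phi> c x u) (\<phi> c x v) = g c x u v - \<eta> c x u * \<eta> c x v))"


section \<open>Differential operators in a chart\<close>

text \<open>Throughout this section the arguments are coordinate expressions in one chart.\<close>

definition Phi :: "metric \<Rightarrow> endo \<Rightarrow> field2" where
  "Phi g \<phi> x u v = g x u (\<phi> x v)"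

text \<open>The Levi-Civita connection is the unique torsion-free metric connection. In a chart,
  a connection is given by its Christoffel symbols \<open>C u v = \<nabla>\<^sub>u v\<close> (for \<open>v\<close> with constant
  coefficients); it is torsion-free iff \<open>C\<close> is symmetric. See \<open>ex1_christoffel\<close> below.\<close>

definition levi_civita_at :: "metric \<Rightarrow> vec5 \<Rightarrow> (vec5 \<Rightarrow> vec5 \<Rightarrow> vec5) \<Rightarrow> bool" where
  "levi_civita_at g x C \<longleftrightarrow>
     bilinear C \<and> (\<forall>u v. C u v = C v u) \<and>
     (\<forall>u v w. frechet_derivative (\<lambda>y. g y v w) (at x) u = g x (C u v) w + g x v (C u w))"

definition christoffel :: "metric \<Rightarrow> vec5 \<Rightarrow> vec5 \<Rightarrow> vec5 \<Rightarrow> vec5" where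
  "christoffel g x = (THE C. levi_civita_at g x C)"

lemma ex1_christoffel:
  assumes D: "open D" "x \<in> D"
    and bil: "\<And>y. y \<in> D \<Longrightarrow> bilinear (g y)"
    and sym: "\<And>y u v. y \<in> D \<Longrightarrow> g y u v = g y v u"
    and pos: "\<And>u. u \<noteq> 0 \<Longrightarrow> g x u u > 0"
    and diff: "\<And>u v. (\<lambda>y. g y u v) differentiable at x"
  shows "\<exists>!C. levi_civita_at g x C"
proof -
  define T where "T u v w = frechet_derivative (\<lambda>y. g y v w) (at x) u" for u v w
  have hd: "((\<lambda>y. g y v w) has_derivative (\<lambda>u. T u v w)) (at x)" for v w
    using diff[of v w] unfolding T_def frechet_derivative_works by simp
  have T1: "linear (\<lambda>u. T u v w)" for v w
    using hd has_derivative_linear by blast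
  have eqI: "T u v w = f u" if "((\<lambda>y. h y) has_derivative f) (at x)" "\<And>y. y \<in> D \<Longrightarrow> h y = g y v w"
    for u v w h f
  proof -
    have "((\<lambda>y. g y v w) has_derivative f) (at x)"
      by (rule has_derivative_transform_within_open[OF that(1) D]) (simp add: that(2))
    then have "(\<lambda>u. T u v w) = f" by (rule has_derivative_unique[OF hd])
    then show ?thesis by (rule fun_cong)
  qed
  have Tsym: "T u v w = T u w v" for u v w
    by (rule eqI[OF hd]) (rule sym)
  have T2: "linear (\<lambda>v. T u v w)" for u w
  proof (rule linearI)
    fix a b r
    show "T u (a + b) w = T u a w + T u b w"
      by (rule eqI[OF has_derivative_add[OF hd hd]]) (simp add: bilinear_ladd[OF bil])
    show "T u (r *\<^sub>R a) w = r *\<^sub>R T u a w"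
      by (rule eqI[OF has_derivative_scaleR_right[OF hd]]) (simp add: bilinear_lmul[OF bil])
  qed
  have T3: "linear (\<lambda>w. T u v w)" for u v
    using T2[of u v] by (subst Tsym)
  note T_add = T1[THEN linear_add] T2[THEN linear_add] T3[THEN linear_add]
  note T_scale = T1[THEN linear_scale] T2[THEN linear_scale] T3[THEN linear_scale]
  note B = bil[OF D(2)]
  note g_add = bilinear_ladd[OF B] bilinear_radd[OF B]
  note g_diff = bilinear_lsub[OF B] bilinear_rsub[OF B]
  note g_scale = bilinear_lmul[OF B] bilinear_rmul[OF B]
  have nondeg: "a = b" if "\<And>w. g x a w = g x b w" for a b
  proof (rule ccontr)
    assume "a \<noteq> b"
    then have "g x (a - b) (a - b) > 0" using pos by simp
    then show False using that by (simp add: g_diff)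
  qed
  define K where "K u v w = (T u v w + T v u w - T w u v) / 2" for u v w
  have K_sym: "K u v w = K v u w" for u v w
    using Tsym[of w u v] by (simp add: K_def)
  have K_add: "K (a + b) v w = K a v w + K b v w" "K v (a + b) w = K v a w + K v b w"
      "K u v (a + b) = K u v a + K u v b" for a b u v w
    by (simp_all add: K_def T_add field_simps)
  have K_scale: "K (r *\<^sub>R a) v w = r * K a v w" "K v (r *\<^sub>R a) w = r * K v a w"
      "K u v (r *\<^sub>R a) = r * K u v a" for r a u v w
    by (simp_all add: K_def T_scale field_simps)
  define L where "L z = (\<chi> i. g x z (axis i 1))" for z
  have g_axis: "f w = (\<Sum>i\<in>UNIV. w $ i * f (axis i 1))" if "linear f" for f :: "vec5 \<Rightarrow> real" and w
  proof -
    have "f w = f (\<Sum>i\<in>UNIV. w $ i *\<^sub>R axis i 1)"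
      using basis_expansion[of w] by (simp add: scalar_mult_eq_scaleR)
    then show ?thesis by (simp add: linear_sum[OF that] linear_scale[OF that])
  qed
  have lin_ext: "f w = h w"
    if "linear f" "linear h" "\<And>i. f (axis i 1) = h (axis i 1)" for f h :: "vec5 \<Rightarrow> real" and w
  proof -
    have "f w = (\<Sum>i\<in>UNIV. w $ i * f (axis i 1))" by (rule g_axis[OF that(1)])
    also have "\<dots> = (\<Sum>i\<in>UNIV. w $ i * h (axis i 1))" by (simp only: that(3))
    also have "\<dots> = h w" by (rule g_axis[OF that(2), symmetric])
    finally show ?thesis .
  qed
  have gl: "linear (g x z)" for z using B by (simp add: bilinear_def)
  have L_lin: "linear L"
    by (rule linearI) (simp_all add: L_def vec_eq_iff g_add g_scale)
  have L_inj: "inj L"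
  proof (rule injI)
    fix a b assume "L a = L b"
    then have "g x a (axis i 1) = g x b (axis i 1)" for i by (simp add: L_def vec_eq_iff)
    then show "a = b" by (rule nondeg[OF lin_ext[OF gl gl]])
  qed
  have "surj L" by (rule linear_injective_imp_surjective[OF L_lin L_inj]) simp
  have Kl: "linear (K u v)" for u v by (rule linearI) (simp_all add: K_add K_scale)
  have "\<exists>z. \<forall>w. g x z w = K u v w" for u v
  proof -
    obtain z where z: "L z = (\<chi> i. K u v (axis i 1))" using surjD[OF \<open>surj L\<close>] by metis
    then have "g x z (axis i 1) = K u v (axis i 1)" for i by (simp add: L_def vec_eq_iff)
    then have "g x z w = K u v w" for w by (rule lin_ext[OF gl Kl])
    then show ?thesis by blast
  qed
  then obtain C where C: "\<And>u v w. g x (C u v) w = K u v w" by metis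
  show ?thesis
  proof (rule ex1I[of _ C])
    have "bilinear C" unfolding bilinear_def
      by (intro conjI allI linearI; rule nondeg) (simp_all add: C g_add g_scale K_add K_scale)
    moreover have "C u v = C v u" for u v by (rule nondeg) (simp add: C K_sym)
    moreover have "T u v w = g x (C u v) w + g x v (C u w)" for u v w
      unfolding sym[OF D(2), of v "C u w"] C K_def
      using Tsym[of u v w] Tsym[of v w u] Tsym[of w v u] by (simp add: field_simps)
    ultimately show "levi_civita_at g x C" by (simp add: levi_civita_at_def T_def)
  next
    fix C' assume C': "levi_civita_at g x C'"
    have s: "C' u v = C' v u" for u v using C' by (simp add: levi_civita_at_def)
    have t: "T u v w = g x (C' u v) w + g x (C' u w) v" for u v w
      using C' sym[OF D(2)] by (simp add: levi_civita_at_def T_def)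
    have "C' u v = C u v" for u v
    proof (rule nondeg)
      fix w
      show "g x (C' u v) w = g x (C u v) w"
        unfolding C K_def t[of u v w] t[of v u w] t[of w u v] s[of v u] s[of w u] s[of w v] by simp
    qed
    then show "C' = C" by (simp add: fun_eq_iff)
  qed
qed

text \<open>\<open>nabla g Y x u\<close> is \<open>\<nabla>\<^sub>u Y\<close> at \<open>x\<close>. For the other tensor fields the arguments \<open>v, w\<close> are
  extended to vector fields with constant coefficients.\<close>

definition nabla :: "metric \<Rightarrow> vfield \<Rightarrow> vec5 \<Rightarrow> vec5 \<Rightarrow> vec5" where
  "nabla g Y x u = frechet_derivative Y (at x) u + christoffel g x u (Y x)"

definition nabla_form1 :: "metric \<Rightarrow> field1 \<Rightarrow> vec5 \<Rightarrow> vec5 \<Rightarrow> form1" where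
  "nabla_form1 g \<alpha> x u v =
     frechet_derivative (\<lambda>y. \<alpha> y v) (at x) u - \<alpha> x (nabla g (\<lambda>y. v) x u)"

definition nabla_form2 :: "metric \<Rightarrow> field2 \<Rightarrow> vec5 \<Rightarrow> vec5 \<Rightarrow> form2" where
  "nabla_form2 g \<alpha> x u v w =
     frechet_derivative (\<lambda>y. \<alpha> y v w) (at x) u
     - \<alpha> x (nabla g (\<lambda>y. v) x u) w - \<alpha> x v (nabla g (\<lambda>y. w) x u)"

definition nabla_endo :: "metric \<Rightarrow> endo \<Rightarrow> vec5 \<Rightarrow> vec5 \<Rightarrow> vec5 \<Rightarrow> vec5" where
  "nabla_endo g \<phi> x u v = nabla g (\<lambda>y. \<phi> y v) x u - \<phi> x (nabla g (\<lambda>y. v) x u)"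

definition orthonormal_at :: "metric \<Rightarrow> vec5 \<Rightarrow> (5 \<Rightarrow> vec5) \<Rightarrow> bool" where
  "orthonormal_at g x b \<longleftrightarrow> (\<forall>i j. g x (b i) (b j) = (if i = j then 1 else 0))"

text \<open>Some orthonormal basis of the tangent space; the operators below do not depend on the choice.\<close>

definition onb :: "metric \<Rightarrow> vec5 \<Rightarrow> 5 \<Rightarrow> vec5" where
  "onb g x = (SOME b. orthonormal_at g x b)"

definition d_form1 :: "metric \<Rightarrow> field1 \<Rightarrow> field2" where
  "d_form1 g \<alpha> x u v =
     (\<Sum>i\<in>UNIV. wedge11 (g x (onb g x i)) (nabla_form1 g \<alpha> x (onb g x i)) u v)"

definition d_form2 :: "metric \<Rightarrow> field2 \<Rightarrow> vec5 \<Rightarrow> form3" where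
  "d_form2 g \<alpha> x u v w =
     (\<Sum>i\<in>UNIV. wedge12 (g x (onb g x i)) (nabla_form2 g \<alpha> x (onb g x i)) u v w)"

definition delta_form1 :: "metric \<Rightarrow> field1 \<Rightarrow> vec5 \<Rightarrow> real" where
  "delta_form1 g \<alpha> x = - (\<Sum>i\<in>UNIV. nabla_form1 g \<alpha> x (onb g x i) (onb g x i))"

definition delta_form2 :: "metric \<Rightarrow> field2 \<Rightarrow> field1" where
  "delta_form2 g \<alpha> x v = - (\<Sum>i\<in>UNIV. nabla_form2 g \<alpha> x (onb g x i) (onb g x i) v)"

definition lie_bracket :: "vfield \<Rightarrow> vfield \<Rightarrow> vfield" where
  "lie_bracket X Y x = frechet_derivative Y (at x) (X x) - frechet_derivative X (at x) (Y x)"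

definition nijenhuis :: "metric \<Rightarrow> vfield \<Rightarrow> field1 \<Rightarrow> endo \<Rightarrow> vfield \<Rightarrow> vfield \<Rightarrow> vfield" where
  "nijenhuis g \<xi> \<eta> \<phi> X Y x =
     lie_bracket (\<lambda>y. \<phi> y (X y)) (\<lambda>y. \<phi> y (Y y)) x
     + \<phi> x (\<phi> x (lie_bracket X Y x))
     - \<phi> x (lie_bracket (\<lambda>y. \<phi> y (X y)) Y x)
     - \<phi> x (lie_bracket X (\<lambda>y. \<phi> y (Y y)) x)
     + d_form1 g \<eta> x (X x) (Y x) *\<^sub>R \<xi> x"


section \<open>Intrinsic torsion\<close>

text \<open>Adapted frames on an open set \<open>U\<close> of coordinates. They are automatically oriented: the
  orientation of the manifold is the one for which \<open>\<Phi> \<and> \<Phi> \<and> \<eta>\<close> is positive.\<close>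

definition adapted_frame ::
    "metric \<Rightarrow> vfield \<Rightarrow> endo \<Rightarrow> vec5 set \<Rightarrow> (5 \<Rightarrow> vfield) \<Rightarrow> bool" where
  "adapted_frame g \<xi> \<phi> U E \<longleftrightarrow>
     (\<forall>i. smooth_on U (E i)) \<and>
     (\<forall>x\<in>U. orthonormal_at g x (\<lambda>i. E i x) \<and> E 5 x = \<xi> x \<and>
        (\<forall>u v. Phi g \<phi> x u v =
            wedge11 (g x (E 1 x)) (g x (E 2 x)) u v + wedge11 (g x (E 3 x)) (g x (E 4 x)) u v))"

text \<open>The connection form \<open>\<Omega>\<^sup>g\<close> and the intrinsic torsion \<open>\<Gamma>\<close> at \<open>x\<close>, read in the local model by
  means of the frame \<open>E\<close>, i.e. \<open>X\<close> in the local model stands for the tangent vector \<open>\<Sum>\<^sub>k X\<^sub>k E\<^sub>k\<close>.\<close>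

definition connection_form :: "metric \<Rightarrow> (5 \<Rightarrow> vfield) \<Rightarrow> vec5 \<Rightarrow> tensor3" where
  "connection_form g E x X Y Z =
     (\<Sum>(i, j) | i < j. g x (nabla g (E i) x (\<Sum>k\<in>UNIV. X $ k *\<^sub>R E k x)) (E j x)
        * wedge11 (dual (e i)) (dual (e j)) Y Z)"

definition intrinsic_torsion :: "metric \<Rightarrow> (5 \<Rightarrow> vfield) \<Rightarrow> vec5 \<Rightarrow> tensor3" where
  "intrinsic_torsion g E x = (\<lambda>X. pr_m (connection_form g E x X))"

text \<open>As the spaces \<open>W i\<close> are \<open>U(2)\<close>-invariant, it does not matter which adapted frame near the
  point is used.\<close>

definition of_class ::
    "'m chart set \<Rightarrow> ('m chart \<Rightarrow> metric) \<Rightarrow> ('m chart \<Rightarrow> vfield) \<Rightarrow> ('m chart \<Rightarrow> endo) \<Rightarrow>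
     nat set \<Rightarrow> bool" where
  "of_class \<A> g \<xi> \<phi> I \<longleftrightarrow>
     (\<forall>c\<in>\<A>. \<forall>x\<in>chart_image c. \<exists>U E. open U \<and> x \<in> U \<and> U \<subseteq> chart_image c \<and>
        adapted_frame (g c) (\<xi> c) (\<phi> c) U E \<and> intrinsic_torsion (g c) E x \<in> W_sum I)"


section \<open>Special types\<close>

text \<open>The Nijenhuis tensor is evaluated on all smooth vector fields \<open>X\<close>, \<open>Y\<close> on open subsets of
  coordinate neighbourhoods.\<close>

definition normal ::
    "'m chart set \<Rightarrow> ('m chart \<Rightarrow> metric) \<Rightarrow> ('m chart \<Rightarrow> vfield) \<Rightarrow> ('m chart \<Rightarrow> field1) \<Rightarrow>
     ('m chart \<Rightarrow> endo) \<Rightarrow> bool" where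
  "normal \<A> g \<xi> \<eta> \<phi> \<longleftrightarrow>
     (\<forall>c\<in>\<A>. \<forall>U X Y. open U \<and> U \<subseteq> chart_image c \<and> smooth_on U X \<and> smooth_on U Y \<longrightarrow>
        (\<forall>x\<in>U. nijenhuis (g c) (\<xi> c) (\<eta> c) (\<phi> c) X Y x = 0))"

definition dPhi_zero :: "'m chart set \<Rightarrow> ('m chart \<Rightarrow> metric) \<Rightarrow> ('m chart \<Rightarrow> endo) \<Rightarrow> bool" where
  "dPhi_zero \<A> g \<phi> \<longleftrightarrow>
     (\<forall>c\<in>\<A>. \<forall>x\<in>chart_image c. \<forall>u v w. d_form2 (g c) (Phi (g c) (\<phi> c)) x u v w = 0)"

definition almost_cosymplectic ::
    "'m chart set \<Rightarrow> ('m chart \<Rightarrow> metric) \<Rightarrow> ('m chart \<Rightarrow> field1) \<Rightarrow> ('m chart \<Rightarrow> endo) \<Rightarrow> bool" where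
  "almost_cosymplectic \<A> g \<eta> \<phi> \<longleftrightarrow>
     dPhi_zero \<A> g \<phi> \<and>
     (\<forall>c\<in>\<A>. \<forall>x\<in>chart_image c. \<forall>u v. d_form1 (g c) (\<eta> c) x u v = 0)"

definition semi_cosymplectic ::
    "'m chart set \<Rightarrow> ('m chart \<Rightarrow> metric) \<Rightarrow> ('m chart \<Rightarrow> field1) \<Rightarrow> ('m chart \<Rightarrow> endo) \<Rightarrow> bool" where
  "semi_cosymplectic \<A> g \<eta> \<phi> \<longleftrightarrow>
     (\<forall>c\<in>\<A>. \<forall>x\<in>chart_image c.
        (\<forall>v. delta_form2 (g c) (Phi (g c) (\<phi> c)) x v = 0) \<and> delta_form1 (g c) (\<eta> c) x = 0)"

definition quasi_cosymplectic ::
    "'m chart set \<Rightarrow> ('m chart \<Rightarrow> metric) \<Rightarrow> ('m chart \<Rightarrow> vfield) \<Rightarrow> ('m chart \<Rightarrow> field1) \<Rightarrow>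
     ('m chart \<Rightarrow> endo) \<Rightarrow> bool" where
  "quasi_cosymplectic \<A> g \<xi> \<eta> \<phi> \<longleftrightarrow>
     (\<forall>c\<in>\<A>. \<forall>x\<in>chart_image c. \<forall>u v.
        nabla_endo (g c) (\<phi> c) x u v + nabla_endo (g c) (\<phi> c) x (\<phi> c x u) (\<phi> c x v)
        = \<eta> c x v *\<^sub>R nabla (g c) (\<xi> c) x (\<phi> c x u))"

definition quasi_Sasaki ::
    "'m chart set \<Rightarrow> ('m chart \<Rightarrow> metric) \<Rightarrow> ('m chart \<Rightarrow> vfield) \<Rightarrow> ('m chart \<Rightarrow> field1) \<Rightarrow>
     ('m chart \<Rightarrow> endo) \<Rightarrow> bool" where
  "quasi_Sasaki \<A> g \<xi> \<eta> \<phi> \<longleftrightarrow> normal \<A> g \<xi> \<eta> \<phi> \<and> dPhi_zero \<A> g \<phi>"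

definition trans_Sasaki ::
    "'m chart set \<Rightarrow> ('m chart \<Rightarrow> metric) \<Rightarrow> ('m chart \<Rightarrow> vfield) \<Rightarrow> ('m chart \<Rightarrow> field1) \<Rightarrow>
     ('m chart \<Rightarrow> endo) \<Rightarrow> bool" where
  "trans_Sasaki \<A> g \<xi> \<eta> \<phi> \<longleftrightarrow>
     (\<forall>c\<in>\<A>. \<forall>x\<in>chart_image c. \<forall>u v w.
        (let delta_Phi_xi = delta_form2 (g c) (Phi (g c) (\<phi> c)) x (\<xi> c x);
             delta_eta = delta_form1 (g c) (\<eta> c) x
         in 4 * nabla_form2 (g c) (Phi (g c) (\<phi> c)) x u v w
            = g c x u (delta_Phi_xi *\<^sub>R w + delta_eta *\<^sub>R \<phi> c x w) * \<eta> c x v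
              - g c x u (delta_Phi_xi *\<^sub>R v + delta_eta *\<^sub>R \<phi> c x v) * \<eta> c x w))"

end

(* Everything happens at one point x. An adapted frame E identifies the tangent space at x
   isometrically with the local model, carrying xi, eta and phi to their model versions. Since the
   coefficients of Phi and xi in the frame are constant, nabla Phi and nabla xi are algebraic in the connection
   form Omega, and since u(2) stabilises Phi and xi, only the m-part of Omega, i.e. the intrinsic
   torsion A, enters:
     (nabla_X eta)(Y) = A(X, xi, Y),
     (nabla_X Phi)(Y, Z) = -(A(X, Y, phi Z) + A(X, phi Y, Z)).
   As the Levi-Civita connection is torsion free, d, delta and the Nijenhuis tensor are expressed
   through nabla phi and nabla eta as well. Each of the special types thus becomes a linear condition
   on A, which is verified on each summand W_i; half of them have the simple shape
   A(X, Y, Z) = eta(Z) b(X, Y) - eta(Y) b(X, Z). *)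

theory Submission
  imports Defs
begin

section \<open>Coordinates on the local model\<close>

text \<open>The simple shape is governed by \<open>A X Y xi0\<close>, which is minus the covariant
  derivative of eta. This bilinear form is a multiple of the horizontal metric on \<open>W1\<close>,
  a multiple of Phi on \<open>W3\<close>, a skew phi-invariant form orthogonal to Phi on
  \<open>W5\<close>, a symmetric form on \<open>W8\<close> and \<open>W10\<close>, preserved by phi
  on the former and reversed on the latter. Invariance of b under phi makes the Nijenhuis tensor
  vanish; symmetry of b(X, phi Y) makes d Phi vanish. \<open>W4\<close> and \<open>W7\<close>
  combine a skew b that phi reverses with a multiple of eta \<otimes> b, while \<open>W6\<close> and
  \<open>W9\<close> vanish as soon as one argument is xi. The obstacle is how the summands are
  given. \<open>W3\<close>, \<open>W5\<close> and \<open>W6\<close> are images under an orthogonal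
  projection introduced by a definite description, so a closed formula for it is needed.
  \<open>W8\<close>, \<open>W9\<close> and \<open>W10\<close> are solution sets of equations, from
  which the shape has to be extracted; for \<open>W8\<close> and \<open>W10\<close> the point is
  that no purely horizontal part survives.\<close>

lemma UNIV_5: "(UNIV :: 5 set) = {1, 2, 3, 4, 5}"
proof -
  have "i = 1 \<or> i = 2 \<or> i = 3 \<or> i = 4 \<or> i = 5" for i :: 5
  proof (induct i)
    case (of_int z)
    then have "z = 0 \<or> z = 1 \<or> z = 2 \<or> z = 3 \<or> z = 4" by auto
    then show ?case by auto
  qed
  then show ?thesis by auto
qed

lemma forall_5: "(\<forall>i::5. P i) \<longleftrightarrow> P 1 \<and> P 2 \<and> P 3 \<and> P 4 \<and> P 5"
proof -
  have "(\<forall>i. P i) \<longleftrightarrow> (\<forall>i\<in>UNIV. P i)" by simp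
  then show ?thesis unfolding UNIV_5 by simp
qed

lemma sum_5: "sum f (UNIV :: 5 set) = f 1 + f 2 + f 3 + f 4 + f 5"
  unfolding UNIV_5 by (simp add: ac_simps)

lemma pairs_5: "{(i, j). i < (j :: 5)} =
  {(5, 1), (5, 2), (5, 3), (5, 4), (1, 2), (1, 3), (1, 4), (2, 3), (2, 4), (3, 4)}"
proof -
  have R: "Rep_bit1 (1 :: 5) = 1" "Rep_bit1 (2 :: 5) = 2" "Rep_bit1 (3 :: 5) = 3"
    "Rep_bit1 (4 :: 5) = 4" "Rep_bit1 (5 :: 5) = 0"
    by (simp_all add: bit1.Rep_numeral bit1.Rep_1)
  have "\<forall>i j. i < (j :: 5) \<longleftrightarrow> (i, j) \<in> {(5, 1), (5, 2), (5, 3), (5, 4),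
      (1, 2), (1, 3), (1, 4), (2, 3), (2, 4), (3, 4)}"
    unfolding forall_5 less_bit1_def R by simp
  then show ?thesis by auto
qed

lemma vector_5:
  "(vector [a, b, c, d, f] :: 'a::zero^5) $ 1 = a"
  "(vector [a, b, c, d, f] :: 'a^5) $ 2 = b"
  "(vector [a, b, c, d, f] :: 'a^5) $ 3 = c"
  "(vector [a, b, c, d, f] :: 'a^5) $ 4 = d"
  "(vector [a, b, c, d, f] :: 'a^5) $ 5 = f"
  unfolding vector_def by simp_all

lemma e_nth: "e i $ j = (if j = i then 1 else 0)"
  by (simp add: e_def axis_def)

text \<open>The 3-form e_i \<and> e_j \<and> e_k; the Hodge dual of a 2-form is expressed in
  these.\<close>

definition minor3 :: "5 \<Rightarrow> 5 \<Rightarrow> 5 \<Rightarrow> vec5 \<Rightarrow> vec5 \<Rightarrow> vec5 \<Rightarrow> real" where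
  "minor3 i j k X Y Z = X $ i * (Y $ j * Z $ k - Y $ k * Z $ j)
     - X $ j * (Y $ i * Z $ k - Y $ k * Z $ i) + X $ k * (Y $ i * Z $ j - Y $ j * Z $ i)"

text \<open>Laplace expansion along the first two rows: with basis vectors in these rows, as in
  \<open>hodge2\<close>, a single complementary minor survives. The columns are taken in the order
  5, 1, 2, 3, 4, a cyclic and hence even rearrangement, so the signs are the usual ones for that
  order.\<close>

lemma det_5:
  fixes A :: "real^5^5"
  defines "d \<equiv> \<lambda>i j. A $ 1 $ i * A $ 2 $ j - A $ 1 $ j * A $ 2 $ i"
    and "m \<equiv> \<lambda>i j k. minor3 i j k (A $ 3) (A $ 4) (A $ 5)"
  shows "det A = d 5 1 * m 2 3 4 - d 5 2 * m 1 3 4 + d 5 3 * m 1 2 4 - d 5 4 * m 1 2 3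
    + d 1 2 * m 3 4 5 - d 1 3 * m 2 4 5 + d 1 4 * m 2 3 5 + d 2 3 * m 1 4 5 - d 2 4 * m 1 3 5
    + d 3 4 * m 1 2 5" (is "_ = ?r")
proof -
  have f: "finite {2::5,3,4,5}" "(1::5)\<notin>{2,3,4,5}" "finite {3::5,4,5}" "(2::5)\<notin>{3,4,5}"
    "finite {4::5,5}" "(3::5)\<notin>{4,5}" "finite {5::5}" "(4::5)\<notin>{5}"
    by auto
  \<comment> \<open>Behind a name, the right-hand side stays untouched while the signs of the 120
    permutations are evaluated.\<close>
  define R where "R = ?r"
  have "det A = R"
    unfolding det_def UNIV_5 sum_over_permutations_insert[OF f(1,2)]
      sum_over_permutations_insert[OF f(3,4)] sum_over_permutations_insert[OF f(5,6)]
      sum_over_permutations_insert[OF f(7,8)] permutes_sing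
    apply (simp add: sign_swap_id permutation_swap_id sign_compose sign_id permutation_compose)
    unfolding R_def d_def m_def minor3_def by algebra
  then show ?thesis by (simp only: R_def)
qed
lemma vol_basis:
  "vol (e 5) (e 1) X Y Z = minor3 2 3 4 X Y Z"
  "vol (e 5) (e 2) X Y Z = - minor3 1 3 4 X Y Z"
  "vol (e 5) (e 3) X Y Z = minor3 1 2 4 X Y Z"
  "vol (e 5) (e 4) X Y Z = - minor3 1 2 3 X Y Z"
  "vol (e 1) (e 2) X Y Z = minor3 3 4 5 X Y Z"
  "vol (e 1) (e 3) X Y Z = - minor3 2 4 5 X Y Z"
  "vol (e 1) (e 4) X Y Z = minor3 2 3 5 X Y Z"
  "vol (e 2) (e 3) X Y Z = minor3 1 4 5 X Y Z"
  "vol (e 2) (e 4) X Y Z = - minor3 1 3 5 X Y Z"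
  "vol (e 3) (e 4) X Y Z = minor3 1 2 5 X Y Z"
  unfolding vol_def det_5 vector_5 by (simp_all add: e_nth)

lemma sum_pairs_5: "(\<Sum>(i, j) | i < (j :: 5). f i j) = f 5 1 + f 5 2 + f 5 3 + f 5 4 + f 1 2
    + f 1 3 + f 1 4 + f 2 3 + f 2 4 + (f 3 4 :: real)"
  unfolding pairs_5 by simp

lemma hodge2_expand: "hodge2 \<alpha> X Y Z =
   \<alpha> (e 5) (e 1) * minor3 2 3 4 X Y Z - \<alpha> (e 5) (e 2) * minor3 1 3 4 X Y Z
   + \<alpha> (e 5) (e 3) * minor3 1 2 4 X Y Z - \<alpha> (e 5) (e 4) * minor3 1 2 3 X Y Z
   + \<alpha> (e 1) (e 2) * minor3 3 4 5 X Y Z - \<alpha> (e 1) (e 3) * minor3 2 4 5 X Y Z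
   + \<alpha> (e 1) (e 4) * minor3 2 3 5 X Y Z + \<alpha> (e 2) (e 3) * minor3 1 4 5 X Y Z
   - \<alpha> (e 2) (e 4) * minor3 1 3 5 X Y Z + \<alpha> (e 3) (e 4) * minor3 1 2 5 X Y Z"
  unfolding hodge2_def sum_pairs_5 vol_basis by simp

lemma eta0_nth: "eta0 X = X $ 5"
  by (simp add: eta0_def dual_def xi0_def e_def inner_axis inner_commute)

lemma phi0_nth: "phi0 X $ 1 = X $ 2" "phi0 X $ 2 = - X $ 1" "phi0 X $ 3 = X $ 4"
    "phi0 X $ 4 = - X $ 3" "phi0 X $ 5 = 0"
  by (simp_all add: phi0_def e_nth)

lemma vec5_eq_iff: "X = (Y :: 'a^5) \<longleftrightarrow>
    X $ 1 = Y $ 1 \<and> X $ 2 = Y $ 2 \<and> X $ 3 = Y $ 3 \<and> X $ 4 = Y $ 4 \<and> X $ 5 = Y $ 5"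
  by (simp add: vec_eq_iff forall_5)

lemma inner_5: "(X :: vec5) \<bullet> Y = X $ 1 * Y $ 1 + X $ 2 * Y $ 2 + X $ 3 * Y $ 3 + X $ 4 * Y $ 4
    + X $ 5 * Y $ 5"
  by (simp add: inner_vec_def sum_5)

lemma phi0_phi0: "phi0 (phi0 X) = - X + eta0 X *\<^sub>R xi0"
  by (simp add: vec5_eq_iff phi0_nth eta0_nth xi0_def e_nth)

lemma phi0_xi0: "phi0 xi0 = 0"
  by (simp add: vec5_eq_iff phi0_nth xi0_def e_nth)

lemma eta0_xi0: "eta0 xi0 = 1"
  by (simp add: eta0_nth xi0_def e_nth)

lemma eta0_phi0: "eta0 (phi0 X) = 0"
  by (simp add: eta0_nth phi0_nth)

lemma linear_eta0: "linear eta0"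
  by (rule linearI) (simp_all add: eta0_nth)

lemma linear_phi0: "linear phi0"
  by (rule linearI) (simp_all add: vec5_eq_iff phi0_nth)

lemma inner_phi0: "phi0 X \<bullet> Y = - (X \<bullet> phi0 Y)"
  by (simp add: inner_5 phi0_nth)

lemma inner_xi0: "X \<bullet> xi0 = eta0 X" "xi0 \<bullet> X = eta0 X"
  by (simp_all add: eta0_def dual_def inner_commute)

lemma phi0_basis: "phi0 (e 1) = - e 2" "phi0 (e 2) = e 1" "phi0 (e 3) = - e 4"
  "phi0 (e 4) = e 3" "phi0 (e 5) = 0"
  by (simp_all add: vec5_eq_iff phi0_nth e_nth)

lemma vec5_expand: "X = X $ 1 *\<^sub>R e 1 + X $ 2 *\<^sub>R e 2 + X $ 3 *\<^sub>R e 3 + X $ 4 *\<^sub>R e 4 + X $ 5 *\<^sub>R e 5"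
  by (simp add: vec5_eq_iff e_nth)

lemma Lam2_anti: "\<alpha> \<in> Lam2 \<Longrightarrow> \<alpha> X Y = - \<alpha> Y X"
  unfolding Lam2_def by blast

lemma Lam2_self: "\<alpha> \<in> Lam2 \<Longrightarrow> \<alpha> X X = 0"
  using Lam2_anti[of \<alpha> X X] by simp

lemma Lam2_linear:
  assumes "\<alpha> \<in> Lam2"
  shows "\<alpha> (X + X') Y = \<alpha> X Y + \<alpha> X' Y" "\<alpha> X (Y + Y') = \<alpha> X Y + \<alpha> X Y'"
    "\<alpha> (X - X') Y = \<alpha> X Y - \<alpha> X' Y" "\<alpha> X (Y - Y') = \<alpha> X Y - \<alpha> X Y'"
    "\<alpha> (- X) Y = - \<alpha> X Y" "\<alpha> X (- Y) = - \<alpha> X Y"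
    "\<alpha> (r *\<^sub>R X) Y = r * \<alpha> X Y" "\<alpha> X (r *\<^sub>R Y) = r * \<alpha> X Y" "\<alpha> 0 Y = 0" "\<alpha> X 0 = 0"
proof -
  have b: "bilinear \<alpha>"
    using assms unfolding Lam2_def by blast
  show "\<alpha> (X + X') Y = \<alpha> X Y + \<alpha> X' Y" "\<alpha> X (Y + Y') = \<alpha> X Y + \<alpha> X Y'"
    "\<alpha> (X - X') Y = \<alpha> X Y - \<alpha> X' Y" "\<alpha> X (Y - Y') = \<alpha> X Y - \<alpha> X Y'"
    "\<alpha> (- X) Y = - \<alpha> X Y" "\<alpha> X (- Y) = - \<alpha> X Y"
    "\<alpha> (r *\<^sub>R X) Y = r * \<alpha> X Y" "\<alpha> X (r *\<^sub>R Y) = r * \<alpha> X Y" "\<alpha> 0 Y = 0" "\<alpha> X 0 = 0"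
    by (simp_all add: bilinear_ladd[OF b] bilinear_radd[OF b] bilinear_lsub[OF b] bilinear_rsub[OF b]
      bilinear_lneg[OF b] bilinear_rneg[OF b] bilinear_lmul[OF b] bilinear_rmul[OF b]
      bilinear_lzero[OF b] bilinear_rzero[OF b])
qed

lemma Lam2_expand:
  assumes "\<alpha> \<in> Lam2"
  shows "\<alpha> X Y = \<alpha> (e 5) (e 1) * (X $ 5 * Y $ 1 - X $ 1 * Y $ 5)
    + \<alpha> (e 5) (e 2) * (X $ 5 * Y $ 2 - X $ 2 * Y $ 5)
    + \<alpha> (e 5) (e 3) * (X $ 5 * Y $ 3 - X $ 3 * Y $ 5)
    + \<alpha> (e 5) (e 4) * (X $ 5 * Y $ 4 - X $ 4 * Y $ 5)
    + \<alpha> (e 1) (e 2) * (X $ 1 * Y $ 2 - X $ 2 * Y $ 1)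
    + \<alpha> (e 1) (e 3) * (X $ 1 * Y $ 3 - X $ 3 * Y $ 1)
    + \<alpha> (e 1) (e 4) * (X $ 1 * Y $ 4 - X $ 4 * Y $ 1)
    + \<alpha> (e 2) (e 3) * (X $ 2 * Y $ 3 - X $ 3 * Y $ 2)
    + \<alpha> (e 2) (e 4) * (X $ 2 * Y $ 4 - X $ 4 * Y $ 2)
    + \<alpha> (e 3) (e 4) * (X $ 3 * Y $ 4 - X $ 4 * Y $ 3)" (is "_ = ?rhs")
proof -
  note l = Lam2_linear[OF assms] and a = Lam2_anti[OF assms]
  have "\<alpha> X Y = \<alpha> (X $ 1 *\<^sub>R e 1 + X $ 2 *\<^sub>R e 2 + X $ 3 *\<^sub>R e 3 + X $ 4 *\<^sub>R e 4 + X $ 5 *\<^sub>R e 5)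
      (Y $ 1 *\<^sub>R e 1 + Y $ 2 *\<^sub>R e 2 + Y $ 3 *\<^sub>R e 3 + Y $ 4 *\<^sub>R e 4 + Y $ 5 *\<^sub>R e 5)"
    using vec5_expand[of X] vec5_expand[of Y] by simp
  also have "\<dots> = ?rhs"
    unfolding l Lam2_self[OF assms]
    unfolding a[of "e 1" "e 5"] a[of "e 2" "e 5"] a[of "e 3" "e 5"] a[of "e 4" "e 5"] a[of "e 2" "e 1"]
      a[of "e 3" "e 1"] a[of "e 4" "e 1"] a[of "e 3" "e 2"] a[of "e 4" "e 2"] a[of "e 4" "e 3"]
    by algebra
  finally show ?thesis .
qed

section \<open>The projection onto m\<close>

lemma Lam2I:
  assumes "\<And>X X' Y. \<alpha> (X + X') Y = \<alpha> X Y + \<alpha> X' Y" "\<And>r X Y. \<alpha> (r *\<^sub>R X) Y = r * \<alpha> X Y"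
    "\<And>X Y. \<alpha> X Y = - \<alpha> Y X"
  shows "\<alpha> \<in> Lam2"
proof -
  have r: "\<alpha> X (Y + Y') = \<alpha> X Y + \<alpha> X Y'" "\<alpha> X (c *\<^sub>R Y) = c * \<alpha> X Y" for X Y Y' c
    using assms(3)[of X] by (simp_all add: assms(1,2))
  have "bilinear \<alpha>"
    unfolding bilinear_def by (intro conjI allI linearI) (simp_all add: r assms(1,2))
  then show ?thesis
    using assms(3) unfolding Lam2_def by blast
qed

lemma Lam2_basis_anti:
  assumes "\<alpha> \<in> Lam2"
  shows "\<alpha> (e 1) (e 5) = - \<alpha> (e 5) (e 1)" "\<alpha> (e 2) (e 5) = - \<alpha> (e 5) (e 2)"
    "\<alpha> (e 3) (e 5) = - \<alpha> (e 5) (e 3)" "\<alpha> (e 4) (e 5) = - \<alpha> (e 5) (e 4)"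
    "\<alpha> (e 2) (e 1) = - \<alpha> (e 1) (e 2)" "\<alpha> (e 3) (e 1) = - \<alpha> (e 1) (e 3)"
    "\<alpha> (e 4) (e 1) = - \<alpha> (e 1) (e 4)" "\<alpha> (e 3) (e 2) = - \<alpha> (e 2) (e 3)"
    "\<alpha> (e 4) (e 2) = - \<alpha> (e 2) (e 4)" "\<alpha> (e 4) (e 3) = - \<alpha> (e 3) (e 4)"
  by (rule Lam2_anti[OF assms])+

section \<open>The summands of the 2-forms in coordinates\<close>

lemma Phi0_nth: "Phi0 X Y = X $ 1 * Y $ 2 - X $ 2 * Y $ 1 + X $ 3 * Y $ 4 - X $ 4 * Y $ 3"
  by (simp add: Phi0_def inner_5 phi0_nth)

text \<open>The Hodge condition kills the components with index 5 and equates complementary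
  horizontal ones; vanishing of Phi \<and> \<alpha> makes the components 12 and 34 opposite as well
  as equal. What remains is the plane of horizontal forms that phi reverses.\<close>

lemma Lam2_2_basis:
  assumes "\<alpha> \<in> Lam2_2"
  shows "\<alpha> (e 5) (e 1) = 0" "\<alpha> (e 5) (e 2) = 0" "\<alpha> (e 5) (e 3) = 0" "\<alpha> (e 5) (e 4) = 0"
    "\<alpha> (e 1) (e 2) = 0" "\<alpha> (e 3) (e 4) = 0" "\<alpha> (e 2) (e 4) = - \<alpha> (e 1) (e 3)"
    "\<alpha> (e 2) (e 3) = \<alpha> (e 1) (e 4)"
proof -
  have h: "hodge2 \<alpha> (e i) (e j) (e k) = wedge12 eta0 \<alpha> (e i) (e j) (e k)" for i j k
    using assms by (simp add: Lam2_2_def)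
  have w: "wedge22 Phi0 \<alpha> (e 1) (e 2) (e 3) (e 4) = 0"
    using assms by (simp add: Lam2_2_def)
  note simps = hodge2_expand minor3_def wedge12_def wedge22_def eta0_nth e_nth Phi0_nth
  show "\<alpha> (e 5) (e 1) = 0" "\<alpha> (e 5) (e 2) = 0" "\<alpha> (e 5) (e 3) = 0" "\<alpha> (e 5) (e 4) = 0"
    "\<alpha> (e 1) (e 2) = 0" "\<alpha> (e 3) (e 4) = 0" "\<alpha> (e 2) (e 4) = - \<alpha> (e 1) (e 3)"
    "\<alpha> (e 2) (e 3) = \<alpha> (e 1) (e 4)"
    using h[of 2 3 4] h[of 1 3 4] h[of 1 2 4] h[of 1 2 3] h[of 3 4 5] h[of 2 4 5] h[of 2 3 5] w
    by (simp_all add: simps)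
qed

lemma Lam2_3_basis:
  assumes "\<alpha> \<in> Lam2_3"
  shows "\<alpha> (e 5) (e 1) = 0" "\<alpha> (e 5) (e 2) = 0" "\<alpha> (e 5) (e 3) = 0" "\<alpha> (e 5) (e 4) = 0"
    "\<alpha> (e 3) (e 4) = - \<alpha> (e 1) (e 2)" "\<alpha> (e 2) (e 4) = \<alpha> (e 1) (e 3)"
    "\<alpha> (e 2) (e 3) = - \<alpha> (e 1) (e 4)"
proof -
  have h: "hodge2 \<alpha> (e i) (e j) (e k) = - wedge12 eta0 \<alpha> (e i) (e j) (e k)" for i j k
    using assms by (simp add: Lam2_3_def)
  note simps = hodge2_expand minor3_def wedge12_def eta0_nth e_nth
  show "\<alpha> (e 5) (e 1) = 0" "\<alpha> (e 5) (e 2) = 0" "\<alpha> (e 5) (e 3) = 0" "\<alpha> (e 5) (e 4) = 0"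
    "\<alpha> (e 3) (e 4) = - \<alpha> (e 1) (e 2)" "\<alpha> (e 2) (e 4) = \<alpha> (e 1) (e 3)"
    "\<alpha> (e 2) (e 3) = - \<alpha> (e 1) (e 4)"
    using h[of 2 3 4] h[of 1 3 4] h[of 1 2 4] h[of 1 2 3] h[of 3 4 5] h[of 2 4 5] h[of 2 3 5]
    by (simp_all add: simps)
qed

text \<open>Converse of \<open>Lam2_2_basis\<close>, needed to recognise the horizontal part of
  \<open>m_part\<close> as an element of \<open>Lam2_2\<close>.\<close>

lemma Lam2_2I:
  assumes \<alpha>: "\<alpha> \<in> Lam2"
    and "\<alpha> (e 5) (e 1) = 0" "\<alpha> (e 5) (e 2) = 0" "\<alpha> (e 5) (e 3) = 0" "\<alpha> (e 5) (e 4) = 0"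
    "\<alpha> (e 1) (e 2) = 0" "\<alpha> (e 3) (e 4) = 0" "\<alpha> (e 2) (e 4) = - \<alpha> (e 1) (e 3)"
    "\<alpha> (e 2) (e 3) = \<alpha> (e 1) (e 4)"
  shows "\<alpha> \<in> Lam2_2"
proof -
  have ex: "\<alpha> X Y = \<alpha> (e 1) (e 3) * (X $ 1 * Y $ 3 - X $ 3 * Y $ 1 - X $ 2 * Y $ 4 + X $ 4 * Y $ 2)
     + \<alpha> (e 1) (e 4) * (X $ 1 * Y $ 4 - X $ 4 * Y $ 1 + X $ 2 * Y $ 3 - X $ 3 * Y $ 2)" for X Y
    unfolding Lam2_expand[OF \<alpha>, of X Y] unfolding assms(2-) by algebra
  have h: "hodge2 \<alpha> X Y Z = wedge12 eta0 \<alpha> X Y Z" for X Y Z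
    unfolding hodge2_expand unfolding assms(2-)
    unfolding wedge12_def eta0_nth minor3_def ex[of X Y] ex[of X Z] ex[of Y Z] by algebra
  have w: "wedge22 Phi0 \<alpha> X Y Z T = 0" for X Y Z T
    unfolding wedge22_def Phi0_nth ex[of X Y] ex[of X Z] ex[of Y Z] ex[of X T] ex[of Y T] ex[of Z T]
    by algebra
  show ?thesis
    using \<alpha> h w by (simp add: Lam2_2_def fun_eq_iff)
qed

lemma Lam2_4_basis:
  assumes "\<alpha> \<in> Lam2_4" "i \<noteq> 5" "j \<noteq> 5"
  shows "\<alpha> (e i) (e j) = 0"
proof -
  have "wedge12 eta0 \<alpha> (e 5) (e i) (e j) = 0"
    using assms by (simp add: Lam2_4_def)
  then show ?thesis
    using assms by (simp add: wedge12_def eta0_nth e_nth)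
qed

lemma Lam2_2_Lam2: "\<alpha> \<in> Lam2_2 \<Longrightarrow> \<alpha> \<in> Lam2"
  and Lam2_3_Lam2: "\<alpha> \<in> Lam2_3 \<Longrightarrow> \<alpha> \<in> Lam2"
  and Lam2_4_Lam2: "\<alpha> \<in> Lam2_4 \<Longrightarrow> \<alpha> \<in> Lam2"
  by (simp_all add: Lam2_2_def Lam2_3_def Lam2_4_def)

lemma Lam2_2_type:
  assumes "\<alpha> \<in> Lam2_2"
  shows "\<alpha> (phi0 X) (phi0 Y) = - \<alpha> X Y" "\<alpha> xi0 X = 0" "\<alpha> X xi0 = 0"
proof -
  note L = Lam2_expand[OF Lam2_2_Lam2[OF assms], unfolded Lam2_2_basis[OF assms]]
  show "\<alpha> (phi0 X) (phi0 Y) = - \<alpha> X Y"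
    unfolding L[of X Y] L[of "phi0 X" "phi0 Y"] phi0_nth by algebra
  show "\<alpha> xi0 X = 0" "\<alpha> X xi0 = 0"
    unfolding L[of xi0 X] L[of X xi0] by (simp_all add: xi0_def e_nth)
qed

lemma Lam2_3_type:
  assumes "\<alpha> \<in> Lam2_3"
  shows "\<alpha> (phi0 X) (phi0 Y) = \<alpha> X Y" "\<alpha> xi0 X = 0" "\<alpha> X xi0 = 0"
proof -
  note L = Lam2_expand[OF Lam2_3_Lam2[OF assms], unfolded Lam2_3_basis[OF assms]]
  show "\<alpha> (phi0 X) (phi0 Y) = \<alpha> X Y"
    unfolding L[of X Y] L[of "phi0 X" "phi0 Y"] phi0_nth by algebra
  show "\<alpha> xi0 X = 0" "\<alpha> X xi0 = 0"
    unfolding L[of xi0 X] L[of X xi0] by (simp_all add: xi0_def e_nth)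
qed

lemma m_space_basis:
  assumes "\<beta> \<in> m_space"
  shows "\<beta> \<in> Lam2" "\<beta> (e 1) (e 2) = 0" "\<beta> (e 3) (e 4) = 0" "\<beta> (e 2) (e 4) = - \<beta> (e 1) (e 3)"
    "\<beta> (e 2) (e 3) = \<beta> (e 1) (e 4)"
proof -
  obtain \<gamma> \<delta> where \<beta>: "\<beta> = (\<lambda>X Y. \<gamma> X Y + \<delta> X Y)" and \<gamma>: "\<gamma> \<in> Lam2_2" and \<delta>: "\<delta> \<in> Lam2_4"
    using assms by (auto simp: m_space_def)
  note L = Lam2_2_Lam2[OF \<gamma>] Lam2_4_Lam2[OF \<delta>]
  show "\<beta> \<in> Lam2"
  proof (rule Lam2I)
    show "\<beta> X Y = - \<beta> Y X" for X Y
      unfolding \<beta> using Lam2_anti[OF L(1), of X Y] Lam2_anti[OF L(2), of X Y] by simp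
  qed (simp_all add: \<beta> Lam2_linear[OF L(1)] Lam2_linear[OF L(2)] distrib_left)
  show "\<beta> (e 1) (e 2) = 0" "\<beta> (e 3) (e 4) = 0" "\<beta> (e 2) (e 4) = - \<beta> (e 1) (e 3)"
    "\<beta> (e 2) (e 3) = \<beta> (e 1) (e 4)"
    unfolding \<beta> by (simp_all add: Lam2_2_basis[OF \<gamma>] Lam2_4_basis[OF \<delta>])
qed

text \<open>On horizontal vectors \<open>u(2)\<close> consists of the \<open>\<phi>\<close>-invariant 2-forms and the rest of
  \<open>so(4)\<close> is \<open>\<phi>\<close>-anti-invariant; the two terms with \<open>eta0\<close> restore the mixed components,
  which lie entirely in \<open>m\<close>.\<close>

definition m_part :: "form2 \<Rightarrow> form2" where
  "m_part \<alpha> X Y = (\<alpha> X Y + eta0 X * \<alpha> xi0 Y + eta0 Y * \<alpha> X xi0 - \<alpha> (phi0 X) (phi0 Y)) / 2"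

lemmas phi0_linear = linear_add[OF linear_phi0] linear_scale[OF linear_phi0]
  linear_neg[OF linear_phi0]
  linear_diff[OF linear_phi0] linear_0[OF linear_phi0]
lemmas eta0_linear = linear_add[OF linear_eta0] linear_scale[OF linear_eta0]
  linear_neg[OF linear_eta0]
  linear_diff[OF linear_eta0] linear_0[OF linear_eta0]

lemma m_part_in_m_space:
  assumes \<alpha>: "\<alpha> \<in> Lam2"
  shows "m_part \<alpha> \<in> m_space"
proof -
  note l = Lam2_linear[OF \<alpha>]
  \<comment> \<open>\<open>\<delta>\<close> collects the components of \<open>\<alpha>\<close> with
    one index xi. Then \<alpha> - \<delta> is horizontal, and \<open>\<gamma>\<close> below is its
    part reversed by phi.\<close>
  define \<delta> where "\<delta> X Y = eta0 X * \<alpha> xi0 Y + eta0 Y * \<alpha> X xi0" for X Y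
  define \<gamma> where "\<gamma> X Y = m_part \<alpha> X Y - \<delta> X Y" for X Y
  have "\<delta> \<in> Lam2"
  proof (rule Lam2I)
    show "\<delta> X Y = - \<delta> Y X" for X Y
      using Lam2_anti[OF \<alpha>, of X xi0] Lam2_anti[OF \<alpha>, of Y xi0] by (simp add: \<delta>_def)
  qed (simp_all add: \<delta>_def l eta0_linear algebra_simps)
  moreover have "wedge12 eta0 \<delta> X Y Z = 0" for X Y Z
    unfolding wedge12_def \<delta>_def Lam2_anti[OF \<alpha>, of _ xi0] by algebra
  ultimately have \<delta>: "\<delta> \<in> Lam2_4"
    by (simp add: Lam2_4_def fun_eq_iff)
  have "\<gamma> \<in> Lam2"
  proof (rule Lam2I)
    show "\<gamma> X Y = - \<gamma> Y X" for X Y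
      using Lam2_anti[OF \<alpha>, of X Y] Lam2_anti[OF \<alpha>, of X xi0] Lam2_anti[OF \<alpha>, of Y xi0]
        Lam2_anti[OF \<alpha>, of "phi0 X" "phi0 Y"] by (simp add: \<gamma>_def \<delta>_def m_part_def field_simps)
  qed (simp_all add: \<gamma>_def \<delta>_def m_part_def l eta0_linear phi0_linear field_simps)
  then have \<gamma>: "\<gamma> \<in> Lam2_2"
    by (rule Lam2_2I)
      (simp_all add: \<gamma>_def \<delta>_def m_part_def phi0_basis eta0_nth e_nth l xi0_def Lam2_self[OF \<alpha>]
        Lam2_basis_anti[OF \<alpha>] field_simps)
  have "m_part \<alpha> = (\<lambda>X Y. \<gamma> X Y + \<delta> X Y)"
    by (simp add: fun_eq_iff \<gamma>_def)
  with \<gamma> \<delta> show ?thesis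
    unfolding m_space_def by blast
qed

lemma inner2_expand: "inner2 \<alpha> \<beta> = \<alpha> (e 5) (e 1) * \<beta> (e 5) (e 1) + \<alpha> (e 5) (e 2) * \<beta> (e 5) (e 2)
    + \<alpha> (e 5) (e 3) * \<beta> (e 5) (e 3) + \<alpha> (e 5) (e 4) * \<beta> (e 5) (e 4)
    + \<alpha> (e 1) (e 2) * \<beta> (e 1) (e 2) + \<alpha> (e 1) (e 3) * \<beta> (e 1) (e 3)
    + \<alpha> (e 1) (e 4) * \<beta> (e 1) (e 4) + \<alpha> (e 2) (e 3) * \<beta> (e 2) (e 3)
    + \<alpha> (e 2) (e 4) * \<beta> (e 2) (e 4) + \<alpha> (e 3) (e 4) * \<beta> (e 3) (e 4)"
  unfolding inner2_def sum_pairs_5 ..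

text \<open>Trades the definite description for a formula, on which all computations with
  \<open>pr_W\<close> and with the intrinsic torsion rest.\<close>

lemma pr_m_eq:
  assumes \<alpha>: "\<alpha> \<in> Lam2"
  shows "pr_m \<alpha> = m_part \<alpha>"
  unfolding pr_m_def
proof (rule the_equality)
  have orth: "inner2 (\<lambda>X Y. \<alpha> X Y - m_part \<alpha> X Y) \<gamma> = 0" if "\<gamma> \<in> m_space" for \<gamma>
    unfolding inner2_expand m_space_basis[OF that]
    by (simp add: m_part_def phi0_basis eta0_nth e_nth Lam2_linear[OF \<alpha>] xi0_def Lam2_self[OF \<alpha>]
        Lam2_basis_anti[OF \<alpha>] field_simps)
  with m_part_in_m_space[OF \<alpha>]
  show "m_part \<alpha> \<in> m_space \<and> (\<forall>\<gamma>\<in>m_space. inner2 (\<lambda>X Y. \<alpha> X Y - m_part \<alpha> X Y) \<gamma> = 0)"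
    by blast
  fix \<beta>
  assume \<beta>: "\<beta> \<in> m_space \<and> (\<forall>\<gamma>\<in>m_space. inner2 (\<lambda>X Y. \<alpha> X Y - \<beta> X Y) \<gamma> = 0)"
  define \<delta> where "\<delta> = (\<lambda>X Y. \<beta> X Y - m_part \<alpha> X Y)"
  \<comment> \<open>\<open>\<beta>\<close> and \<open>m_part \<alpha>\<close> lie in m, and both
    remainders are orthogonal to m, so each of the four products vanishes: \<open>\<delta>\<close>
    is orthogonal to itself.\<close>
  have "inner2 \<delta> \<delta> = inner2 (\<lambda>X Y. \<alpha> X Y - m_part \<alpha> X Y) \<beta> - inner2 (\<lambda>X Y. \<alpha> X Y - \<beta> X Y) \<beta>
      - inner2 (\<lambda>X Y. \<alpha> X Y - m_part \<alpha> X Y) (m_part \<alpha>) + inner2 (\<lambda>X Y. \<alpha> X Y - \<beta> X Y) (m_part \<alpha>)"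
    unfolding inner2_expand \<delta>_def by algebra
  also have "\<dots> = 0"
    using \<beta> orth m_part_in_m_space[OF \<alpha>] by simp
  finally have "(\<Sum>p | fst p < snd p. (\<delta> (e (fst p)) (e (snd p)))\<^sup>2) = 0"
    by (simp add: inner2_def split_def power2_eq_square)
  then have "\<delta> (e i) (e j) = 0" if "i < j" for i j
    using that by (subst (asm) sum_nonneg_eq_0_iff) auto
  then have d: "\<beta> (e i) (e j) = m_part \<alpha> (e i) (e j)" if "(i, j) \<in> {(i, j). i < j}" for i j
    using that by (simp add: \<delta>_def)
  have "\<beta> X Y = m_part \<alpha> X Y" for X Y
    unfolding Lam2_expand[OF m_space_basis(1)[OF conjunct1[OF \<beta>]], of X Y]
      Lam2_expand[OF m_space_basis(1)[OF m_part_in_m_space[OF \<alpha>]], of X Y]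
    using d[unfolded pairs_5] by simp
  then show "\<beta> = m_part \<alpha>" by (simp add: fun_eq_iff)
qed

section \<open>The summands W8, W9, W10 and the conditions on the torsion\<close>

lemma A_space_linear:
  assumes "A \<in> A_space"
  shows "A (X + X') Y Z = A X Y Z + A X' Y Z" "A X (Y + Y') Z = A X Y Z + A X Y' Z"
    "A X Y (Z + Z') = A X Y Z + A X Y Z'" "A (- X) Y Z = - A X Y Z" "A X (- Y) Z = - A X Y Z"
    "A X Y (- Z) = - A X Y Z" "A (r *\<^sub>R X) Y Z = r * A X Y Z" "A X (r *\<^sub>R Y) Z = r * A X Y Z"
    "A X Y (r *\<^sub>R Z) = r * A X Y Z" "A 0 Y Z = 0" "A X 0 Z = 0" "A X Y 0 = 0"
    "A (X - X') Y Z = A X Y Z - A X' Y Z" "A X (Y - Y') Z = A X Y Z - A X Y' Z"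
    "A X Y (Z - Z') = A X Y Z - A X Y Z'"
proof -
  have l: "linear (\<lambda>X. A X Y Z)" and b: "bilinear (A X)" for X Y Z
    using assms by (simp_all add: A_space_def)
  show "A (X + X') Y Z = A X Y Z + A X' Y Z" "A X (Y + Y') Z = A X Y Z + A X Y' Z"
    "A X Y (Z + Z') = A X Y Z + A X Y Z'" "A (- X) Y Z = - A X Y Z" "A X (- Y) Z = - A X Y Z"
    "A X Y (- Z) = - A X Y Z" "A (r *\<^sub>R X) Y Z = r * A X Y Z" "A X (r *\<^sub>R Y) Z = r * A X Y Z"
    "A X Y (r *\<^sub>R Z) = r * A X Y Z" "A 0 Y Z = 0" "A X 0 Z = 0" "A X Y 0 = 0"
    "A (X - X') Y Z = A X Y Z - A X' Y Z" "A X (Y - Y') Z = A X Y Z - A X Y' Z"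
    "A X Y (Z - Z') = A X Y Z - A X Y Z'"
    using linear_add[OF l] linear_diff[OF l] linear_neg[OF l] linear_scale[OF l] linear_0[OF l]
    by (simp_all add: bilinear_ladd[OF b] bilinear_radd[OF b] bilinear_lsub[OF b] bilinear_rsub[OF b]
      bilinear_lneg[OF b] bilinear_rneg[OF b]
      bilinear_lmul[OF b] bilinear_rmul[OF b] bilinear_lzero[OF b] bilinear_rzero[OF b])
qed

lemma A_space_anti:
  assumes "A \<in> A_space"
  shows "A X Y Z = - A X Z Y"
proof -
  have "A X Y Z + A X Z Y = 0"
    using assms unfolding A_space_def by blast
  then show ?thesis by simp
qed

lemma A3_space_D:
  assumes "A \<in> A3_space"
  shows "A \<in> A_space" "A X Y Z + A Y Z X + A Z X Y = 0" "(\<Sum>i\<in>UNIV. A (e i) (e i) X) = 0"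
  using assms by (simp_all add: A3_space_def)

text \<open>Covers \<open>W8\<close> (\<open>s = 1\<close>) and \<open>W10\<close> (\<open>s = - 1\<close>): on horizontal vectors the relation gives
  \<open>A X Y Z = 2 s A (\<phi> X) (\<phi> Y) Z\<close>, and twice this gives \<open>A = 4 A\<close>, so the purely horizontal
  part vanishes.\<close>

lemma A3_space_phi_form:
  assumes A3: "A \<in> A3_space" and s: "\<bar>s\<bar> = 1"
    and rel: "\<And>X Y Z. A X Y Z = s * (A (phi0 X) Y (phi0 Z) + A (phi0 X) (phi0 Y) Z)"
  shows "A xi0 Y Z = 0" "A X Y Z = eta0 Z * A X Y xi0 - eta0 Y * A X Z xi0"
    "A X Y xi0 = A Y X xi0" "A X xi0 xi0 = 0" "A (phi0 X) (phi0 Y) xi0 = s * A X Y xi0"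
proof -
  note A = A3_space_D(1)[OF A3]
  note l = A_space_linear[OF A] and anti = A_space_anti[OF A] and bianchi = A3_space_D(2)[OF A3]
  have ss: "s * s = 1"
    using s by (cases "s \<ge> 0") auto
  have xi: "A xi0 Y Z = 0" for Y Z
    using rel[of xi0 Y Z] by (simp add: phi0_xi0 l)
  then show "A xi0 Y Z = 0" .
  show "A X Y xi0 = A Y X xi0"
    using bianchi[of X Y xi0] anti[of Y xi0 X] xi[of X Y] by simp
  show xixi: "A X xi0 xi0 = 0" for X
    using anti[of X xi0 xi0] by simp
  have inv: "A X Y xi0 = s * A (phi0 X) (phi0 Y) xi0" for X Y
    using rel[of X Y xi0] by (simp add: phi0_xi0 l)
  then show "A (phi0 X) (phi0 Y) xi0 = s * A X Y xi0"
    using ss by (metis mult.assoc mult_1)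
  \<comment> \<open>On horizontal vectors the right side of \<open>rel\<close> changes sign when
    \<open>phi0\<close> is applied to both Y and Z, hence so does A. Equivalently,
    \<open>phi0\<close> may be moved from one of the last two arguments to the other. Images of
    \<open>phi0\<close> stand for horizontal vectors, on which \<open>phi0\<close> squares to minus
    the identity.\<close>
  have turn: "A Z (phi0 (phi0 X)) (phi0 Y) = A Z (phi0 X) (phi0 (phi0 Y))" for X Y Z
  proof -
    have "A Z (phi0 (phi0 X)) (phi0 (phi0 (phi0 Y))) = - A Z (phi0 X) (phi0 (phi0 Y))"
      unfolding rel[of Z "phi0 (phi0 X)" "phi0 (phi0 (phi0 Y))"] rel[of Z "phi0 X" "phi0 (phi0 Y)"]
      by (simp add: phi0_phi0 phi0_linear phi0_xi0 l eta0_phi0 algebra_simps)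
    then show ?thesis
      by (simp add: phi0_phi0[of "phi0 Y"] eta0_phi0 l)
  qed
  have step: "A X (phi0 Y) (phi0 Z) = 2 * s * A (phi0 X) (phi0 (phi0 Y)) (phi0 Z)" for X Y Z
    unfolding rel[of X "phi0 Y" "phi0 Z"] using turn[of "phi0 X" Y Z] by simp
  have "A (phi0 X) (phi0 Y) (phi0 Z) = 0" for X Y Z
  proof -
    have "A (phi0 X) (phi0 Y) (phi0 Z)
        = 2 * s * (2 * s * A (phi0 (phi0 (phi0 X))) (phi0 (phi0 (phi0 Y))) (phi0 Z))"
      using step[of "phi0 X" Y Z] step[of "phi0 (phi0 X)" "phi0 Y" Z] by simp
    also have "\<dots> = 4 * (s * s) * A (phi0 X) (phi0 Y) (phi0 Z)"
      by (simp add: phi0_phi0[of "phi0 X"] phi0_phi0[of "phi0 Y"] eta0_phi0 l)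
    finally show ?thesis
      using ss by simp
  qed
  \<comment> \<open>Each argument becomes its horizontal projection up to sign. Expanding it as X
    minus \<open>eta0 X *\<^sub>R xi0\<close> leaves exactly the terms with an argument
    \<open>xi0\<close>.\<close>
  from this[of "phi0 X" "phi0 Y" "phi0 Z"]
  show "A X Y Z = eta0 Z * A X Y xi0 - eta0 Y * A X Z xi0"
    using anti[of X xi0 Z] by (simp add: phi0_phi0 l xi xixi algebra_simps)
qed

section \<open>Explicit form of W8, W9 and W10\<close>

lemma W8_A3: "A \<in> W8 \<Longrightarrow> A \<in> A3_space"
  and W9_A3: "A \<in> W9 \<Longrightarrow> A \<in> A3_space"
  and W10_A3: "A \<in> W10 \<Longrightarrow> A \<in> A3_space"
  unfolding W8_def W9_def W10_def by blast+

lemma W8_form: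
  assumes "A \<in> W8"
  shows "A X Y Z = eta0 Z * A X Y xi0 - eta0 Y * A X Z xi0" "A X Y xi0 = A Y X xi0"
    "A X xi0 xi0 = 0" "A xi0 Y Z = 0" "A (phi0 X) (phi0 Y) xi0 = A X Y xi0"
proof -
  have rel: "A X Y Z = 1 * (A (phi0 X) Y (phi0 Z) + A (phi0 X) (phi0 Y) Z)" for X Y Z
    unfolding mult_1 using assms unfolding W8_def by blast
  have "\<bar>1 :: real\<bar> = 1" by simp
  note form = A3_space_phi_form[where A = A and s = 1, OF W8_A3[OF assms] this rel]
  show "A X Y Z = eta0 Z * A X Y xi0 - eta0 Y * A X Z xi0" "A X Y xi0 = A Y X xi0"
    "A X xi0 xi0 = 0" "A xi0 Y Z = 0" "A (phi0 X) (phi0 Y) xi0 = A X Y xi0"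
    by (rule form(2), rule form(3), rule form(4), rule form(1), rule form(5)[unfolded mult_1])
qed

lemma W10_form:
  assumes "A \<in> W10"
  shows "A X Y Z = eta0 Z * A X Y xi0 - eta0 Y * A X Z xi0" "A X Y xi0 = A Y X xi0"
    "A X xi0 xi0 = 0" "A xi0 Y Z = 0" "A (phi0 X) (phi0 Y) xi0 = - A X Y xi0"
proof -
  have rel: "A X Y Z = - A (phi0 X) Y (phi0 Z) - A (phi0 X) (phi0 Y) Z" for X Y Z
    using assms unfolding W10_def by blast
  have rel: "A X Y Z = - 1 * (A (phi0 X) Y (phi0 Z) + A (phi0 X) (phi0 Y) Z)" for X Y Z
    unfolding rel[of X Y Z] by simp
  have "\<bar>- 1 :: real\<bar> = 1" by simp
  note form = A3_space_phi_form[where A = A and s = "- 1", OF W10_A3[OF assms] this rel]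
  show "A X Y Z = eta0 Z * A X Y xi0 - eta0 Y * A X Z xi0" "A X Y xi0 = A Y X xi0"
    "A X xi0 xi0 = 0" "A xi0 Y Z = 0" "A (phi0 X) (phi0 Y) xi0 = - A X Y xi0"
    by (rule form(2), rule form(3), rule form(4), rule form(1), simp add: form(5))
qed

lemma W9_form:
  assumes "A \<in> W9"
  shows "A X (phi0 Y) (phi0 Z) = - A X Y Z" "A X xi0 Z = 0" "A X Z xi0 = 0" "A xi0 Y Z = 0"
    "A X (phi0 Y) Z = A X Y (phi0 Z)" "A (phi0 X) Y Z = A X Y (phi0 Z)"
proof -
  note A3 = W9_A3[OF assms]
  have "A X Y Z = - A X (phi0 Y) (phi0 Z)" for X Y Z
    using assms unfolding W9_def by blast
  then have rel: "A X (phi0 Y) (phi0 Z) = - A X Y Z" for X Y Z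
    by (metis minus_minus)
  note A = A3_space_D(1)[OF A3]
  note l = A_space_linear[OF A] and anti = A_space_anti[OF A] and bianchi = A3_space_D(2)[OF A3]
  show "A X (phi0 Y) (phi0 Z) = - A X Y Z" by (rule rel)
  show xi2: "A X xi0 Z = 0" for X Z
    using rel[of X xi0 Z] by (simp add: phi0_xi0 l)
  show xi3: "A X Z xi0 = 0" for X Z
    using xi2[of X Z] anti[of X Z xi0] by simp
  show xi1: "A xi0 Y Z = 0" for Y Z
    using bianchi[of xi0 Y Z] xi2[of Z Y] xi3[of Y Z] by simp
  show turn: "A X (phi0 Y) Z = A X Y (phi0 Z)" for X Y Z
    using rel[of X "phi0 Y" Z] by (simp add: phi0_phi0 l xi2)
  \<comment> \<open>Let a, b, c be the three cyclic terms with \<open>phi0\<close> on the first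
    argument and on one of the other two; by \<open>turn\<close> it does not matter on which. The
    Bianchi identity for the triples with two entries under \<open>phi0\<close> says that the
    pairwise sums of a, b, c are the cyclic terms of A at X, Y, Z. These add up to zero, so a + b +
    c = 0 and a = - A(X, Y, Z).\<close>
  have "A (phi0 X) Y (phi0 Z) = - A X Y Z" for X Y Z
    using bianchi[of X Y Z] bianchi[of "phi0 X" "phi0 Y" Z] bianchi[of "phi0 X" Y "phi0 Z"]
      bianchi[of X "phi0 Y" "phi0 Z"] rel[of Z X Y] rel[of X Y Z] rel[of Y X Z]
      turn[of "phi0 X" Y Z] turn[of "phi0 Y" Z X] turn[of "phi0 Z" X Y] anti[of Y "phi0 Z" "phi0 X"]
      rel[of Y Z X] anti[of Y X Z] anti[of X Y Z] anti[of Z X Y]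
    by linarith
  from this[of X Y "phi0 Z"] show "A (phi0 X) Y Z = A X Y (phi0 Z)"
    by (simp add: phi0_phi0 l xi3)
qed

text \<open>If \<open>A\<close> is the intrinsic torsion then \<open>nabla_Phi0 A\<close> is \<open>\<nabla>\<Phi>\<close> and \<open>A X xi0\<close> is
  \<open>\<nabla>\<^sub>X \<eta>\<close>; the predicates below are the special types rewritten in these terms.\<close>

definition nabla_Phi0 :: "tensor3 \<Rightarrow> tensor3" where
  "nabla_Phi0 A X Y Z = - (A X Y (phi0 Z) + A X (phi0 Y) Z)"

text \<open>The scalar product of N(X, Y) with Z. Where N has an outer phi, skew symmetry moves it
  to Z and changes the sign.\<close>

definition normal0 :: "tensor3 \<Rightarrow> bool" where
  "normal0 A \<longleftrightarrow> (\<forall>X Y Z. nabla_Phi0 A (phi0 X) Z Y - nabla_Phi0 A (phi0 Y) Z X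
     - nabla_Phi0 A Y (phi0 Z) X + nabla_Phi0 A X (phi0 Z) Y + (A X xi0 Y - A Y xi0 X) * eta0 Z = 0)"

definition closed_Phi0 :: "tensor3 \<Rightarrow> bool" where
  "closed_Phi0 A \<longleftrightarrow>
     (\<forall>X Y Z. nabla_Phi0 A X Y Z - nabla_Phi0 A Y X Z + nabla_Phi0 A Z X Y = 0)"

definition closed_eta0 :: "tensor3 \<Rightarrow> bool" where
  "closed_eta0 A \<longleftrightarrow> (\<forall>X Y. A X xi0 Y - A Y xi0 X = 0)"

definition quasi_cosymplectic0 :: "tensor3 \<Rightarrow> bool" where
  "quasi_cosymplectic0 A \<longleftrightarrow>
     (\<forall>X Y Z. nabla_Phi0 A X Z Y + nabla_Phi0 A (phi0 X) Z (phi0 Y) = eta0 Y * A (phi0 X) xi0 Z)"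

definition delta_Phi0 :: "tensor3 \<Rightarrow> form1" where
  "delta_Phi0 A Y = - (\<Sum>i\<in>UNIV. nabla_Phi0 A (e i) (e i) Y)"

definition delta_eta0 :: "tensor3 \<Rightarrow> real" where
  "delta_eta0 A = - (\<Sum>i\<in>UNIV. A (e i) xi0 (e i))"

definition semi_cosymplectic0 :: "tensor3 \<Rightarrow> bool" where
  "semi_cosymplectic0 A \<longleftrightarrow> (\<forall>Y. delta_Phi0 A Y = 0) \<and> delta_eta0 A = 0"

definition trans_Sasaki0 :: "tensor3 \<Rightarrow> bool" where
  "trans_Sasaki0 A \<longleftrightarrow> (\<forall>X Y Z. 4 * nabla_Phi0 A X Y Z
     = (delta_Phi0 A xi0 * (X \<bullet> Z) + delta_eta0 A * (X \<bullet> phi0 Z)) * eta0 Y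
       - (delta_Phi0 A xi0 * (X \<bullet> Y) + delta_eta0 A * (X \<bullet> phi0 Y)) * eta0 Z)"

text \<open>The common reason for normality on \<open>W1\<close>, \<open>W3\<close>,
  \<open>W5\<close> and \<open>W8\<close>: the derivatives of Phi along horizontal directions give
  back b, which cancels against d eta. The invariance is required only up to \<open>b X xi0\<close>,
  because on \<open>W1\<close> b is a multiple of the full scalar product, which does not vanish on
  \<open>xi0\<close>.\<close>

lemma normal0I:
  assumes form: "\<And>X Y Z. A X Y Z = eta0 Z * b X Y - eta0 Y * b X Z"
    and lin: "\<And>X. linear (b X)"
    and type: "\<And>X Y. b (phi0 X) (phi0 Y) = b X Y - eta0 Y * b X xi0"
  shows "normal0 A"
proof -
  have nP: "nabla_Phi0 A X Y Z = eta0 Y * b X (phi0 Z) - eta0 Z * b X (phi0 Y)" for X Y Z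
    by (simp add: nabla_Phi0_def form eta0_phi0)
  have pp: "b X (phi0 (phi0 Z)) = eta0 Z * b X xi0 - b X Z" for X Z
    by (simp add: phi0_phi0 linear_diff[OF lin] linear_add[OF lin] linear_neg[OF lin] linear_scale[OF lin])
  show ?thesis
    unfolding normal0_def nP pp type eta0_phi0 form eta0_xi0 by (simp add: algebra_simps)
qed

lemma W8_normal:
  assumes "A \<in> W8"
  shows "normal0 A"
proof (rule normal0I[where b = "\<lambda>X Y. A X Y xi0"])
  note A = A3_space_D(1)[OF W8_A3[OF assms]]
  show "A X Y Z = eta0 Z * A X Y xi0 - eta0 Y * A X Z xi0" for X Y Z
    by (rule W8_form(1)[OF assms])
  show "linear (\<lambda>Y. A X Y xi0)" for X
    by (rule linearI) (simp_all add: A_space_linear[OF A])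
  show "A (phi0 X) (phi0 Y) xi0 = A X Y xi0 - eta0 Y * A X xi0 xi0" for X Y
    by (simp add: W8_form(3,5)[OF assms])
qed

text \<open>Both codifferentials are traces. The plain trace over the first two arguments vanishes
  on \<open>A3_space\<close>; the trace with \<open>phi0\<close> on the second argument turns by the
  Bianchi identity into the contraction of the 2-form \<open>A Y\<close> with Phi, i.e. into the two
  components assumed to vanish.\<close>

lemma A3_semi_cosymplectic:
  assumes A3: "A \<in> A3_space" and v: "\<And>X. A X (e 1) (e 2) = 0" "\<And>X. A X (e 3) (e 4) = 0"
  shows "semi_cosymplectic0 A"
proof -
  note A = A3_space_D(1)[OF A3]
  note l = A_space_linear[OF A] and anti = A_space_anti[OF A] and bianchi = A3_space_D(2)[OF A3]
  have "delta_eta0 A = (\<Sum>i\<in>UNIV. A (e i) (e i) xi0)"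
    unfolding delta_eta0_def by (simp add: anti[of _ xi0] sum_negf)
  then have "delta_eta0 A = 0"
    by (simp add: A3_space_D(3)[OF A3])
  moreover have "delta_Phi0 A Y = 0" for Y
    using A3_space_D(3)[OF A3, of "phi0 Y"] bianchi[of "e 1" "e 2" Y] bianchi[of "e 3" "e 4" Y]
      v(1)[of Y] v(2)[of Y] anti[of "e 2" "e 1" Y] anti[of "e 4" "e 3" Y]
    by (simp add: delta_Phi0_def nabla_Phi0_def sum_5 phi0_basis l)
  ultimately show ?thesis
    by (simp add: semi_cosymplectic0_def)
qed

lemma W8_semi_cosymplectic: "A \<in> W8 \<Longrightarrow> semi_cosymplectic0 A"
  by (rule A3_semi_cosymplectic, rule W8_A3, assumption)
    (subst W8_form(1), assumption, simp add: eta0_nth e_nth)+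

lemma W10_semi_cosymplectic: "A \<in> W10 \<Longrightarrow> semi_cosymplectic0 A"
  by (rule A3_semi_cosymplectic, rule W10_A3, assumption)
    (subst W10_form(1), assumption, simp add: eta0_nth e_nth)+

lemma W9_semi_cosymplectic: assumes "A \<in> W9" shows "semi_cosymplectic0 A"
proof (rule A3_semi_cosymplectic)
  show A3: "A \<in> A3_space" by (rule W9_A3[OF assms])
  note l = A_space_linear[OF A3_space_D(1)[OF A3]] and anti = A_space_anti[OF A3_space_D(1)[OF A3]]
  show "A X (e 1) (e 2) = 0" "A X (e 3) (e 4) = 0" for X
    using W9_form(1)[OF assms, of X "e 1" "e 2"] W9_form(1)[OF assms, of X "e 3" "e 4"]
      anti[of X "e 2" "e 1"] anti[of X "e 4" "e 3"]
    by (simp_all add: phi0_basis l)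
qed

lemma W9_nabla_Phi0: "A \<in> W9 \<Longrightarrow> nabla_Phi0 A X Y Z = - 2 * A X Y (phi0 Z)"
  using W9_form(5)[of A X Y Z] by (simp add: nabla_Phi0_def)

lemma W9_quasi_cosymplectic: assumes "A \<in> W9" shows "quasi_cosymplectic0 A"
proof -
  have A: "A \<in> A_space" using A3_space_D(1) W9_A3 assms by blast
  show ?thesis
    unfolding quasi_cosymplectic0_def W9_nabla_Phi0[OF assms] W9_form(2)[OF assms]
    by (simp add: phi0_phi0 A_space_linear[OF A] W9_form(3,6)[OF assms])
qed

lemma W9_closed: assumes "A \<in> W9" shows "closed_Phi0 A" "closed_eta0 A"
proof -
  have A3: "A \<in> A3_space" by (rule W9_A3[OF assms])
  have "A X Y (phi0 Z) - A Y X (phi0 Z) + A Z X (phi0 Y) = 0" for X Y Z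
    using A3_space_D(2)[OF A3, of "phi0 Z" X Y] W9_form(5,6)[OF assms]
      A_space_anti[OF A3_space_D(1)[OF A3], of Y X "phi0 Z"] by simp
  then show "closed_Phi0 A"
    unfolding closed_Phi0_def W9_nabla_Phi0[OF assms] by (smt (verit))
  show "closed_eta0 A"
    by (simp add: closed_eta0_def W9_form(2)[OF assms])
qed

text \<open>The defining relation of \<open>W10\<close> reads: the derivative of Phi along
  \<open>phi0 X\<close> is \<open>A X\<close>. Since \<open>A xi0\<close> vanishes, it can be solved
  for the derivative along X.\<close>

lemma W10_nabla_Phi0: assumes "A \<in> W10" shows "nabla_Phi0 A X Y Z = - A (phi0 X) Y Z"
proof -
  have A: "A \<in> A_space" using A3_space_D(1) W10_A3 assms by blast
  have rel: "nabla_Phi0 A (phi0 X) Y Z = A X Y Z" for X Y Z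
  proof -
    have "A X Y Z = - A (phi0 X) Y (phi0 Z) - A (phi0 X) (phi0 Y) Z"
      using assms unfolding W10_def by blast
    then show ?thesis by (simp add: nabla_Phi0_def)
  qed
  show ?thesis
    using rel[of "phi0 X" Y Z] W10_form(4)[OF assms]
    by (simp add: nabla_Phi0_def phi0_phi0 A_space_linear[OF A])
qed

text \<open>Together with the symmetry of \<open>A X Y xi0\<close> this makes
  \<open>A X (phi0 Y) xi0\<close> symmetric in X and Y, which is what closes Phi.\<close>

lemma W10_turn: assumes "A \<in> W10" shows "A (phi0 X) Y xi0 = A X (phi0 Y) xi0"
proof -
  have A: "A \<in> A_space" using A3_space_D(1) W10_A3 assms by blast
  show ?thesis
    using W10_form(5)[OF assms, of X "phi0 Y"]
    by (simp add: phi0_phi0 A_space_linear[OF A] W10_form(3)[OF assms])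
qed

lemma W10_quasi_cosymplectic: assumes "A \<in> W10" shows "quasi_cosymplectic0 A"
proof -
  have A: "A \<in> A_space" using A3_space_D(1) W10_A3 assms by blast
  note f = W10_form[OF assms]
  show ?thesis
    unfolding quasi_cosymplectic0_def W10_nabla_Phi0[OF assms]
  proof (intro allI)
    fix X Y Z
    show "- A (phi0 X) Z Y + - A (phi0 (phi0 X)) Z (phi0 Y) = eta0 Y * A (phi0 X) xi0 Z"
      unfolding f(1)[of "phi0 X" Z Y] f(1)[of "phi0 (phi0 X)" Z "phi0 Y"] f(1)[of "phi0 X" xi0 Z]
      using W10_turn[OF assms, of X Y]
      by (simp add: phi0_phi0 A_space_linear[OF A] f(3,4) eta0_phi0 eta0_xi0 algebra_simps)
  qed
qed

lemma W10_closed: assumes "A \<in> W10" shows "closed_Phi0 A" "closed_eta0 A"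
proof -
  note f = W10_form[OF assms]
  have s: "A (phi0 X) Y xi0 = A (phi0 Y) X xi0" for X Y
    using W10_turn[OF assms, of X Y] f(2)[of X "phi0 Y"] by simp
  show "closed_Phi0 A"
    unfolding closed_Phi0_def W10_nabla_Phi0[OF assms]
  proof (intro allI)
    fix X Y Z
    show "- A (phi0 X) Y Z - - A (phi0 Y) X Z + - A (phi0 Z) X Y = 0"
      unfolding f(1)[of "phi0 X" Y Z] f(1)[of "phi0 Y" X Z] f(1)[of "phi0 Z" X Y]
      using s[of X Y] s[of X Z] s[of Y Z] by simp
  qed
  show "closed_eta0 A"
  proof -
    have "A X xi0 Y = - A X Y xi0" for X Y
      using f(1)[of X xi0 Y] by (simp add: f(3) eta0_xi0)
    then show ?thesis
      unfolding closed_eta0_def using f(2) by simp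
  qed
qed

section \<open>The remaining summands and their sums\<close>

lemma linear_basis_sum: "linear f \<Longrightarrow> (\<Sum>i\<in>UNIV. dual (e i) X * f (e i)) = f X"
proof -
  assume f: "linear f"
  have "f X = f (\<Sum>i\<in>UNIV. X $ i *\<^sub>R e i)"
    using basis_expansion[of X] by (simp add: e_def scalar_mult_eq_scaleR)
  also have "\<dots> = (\<Sum>i\<in>UNIV. dual (e i) X * f (e i))"
    by (simp add: linear_sum[OF f] linear_scale[OF f] dual_def e_def
        inner_commute[of "axis _ _"] inner_axis)
  finally show ?thesis by simp
qed

text \<open>The sum over the basis merely re-expands the first argument: \<open>theta2\<close> is
  the inclusion of 3-forms into the tensors.\<close>

lemma theta2_eq: "(\<And>Y Z. linear (\<lambda>X. \<alpha> X Y Z)) \<Longrightarrow> theta2 \<alpha> = \<alpha>"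
  unfolding fun_eq_iff theta2_def using linear_basis_sum by blast

lemma
  assumes \<gamma>: "linear \<gamma>" and \<alpha>: "\<alpha> \<in> Lam2"
  shows wedge12_linear: "linear (\<lambda>X. wedge12 \<gamma> \<alpha> X Y Z)"
    and wedge12_Lam2: "wedge12 \<gamma> \<alpha> X \<in> Lam2"
proof -
  note l = linear_add[OF \<gamma>] linear_scale[OF \<gamma>] Lam2_linear[OF \<alpha>]
  show "linear (\<lambda>X. wedge12 \<gamma> \<alpha> X Y Z)"
    by (rule linearI) (simp_all add: wedge12_def l algebra_simps)
  show "wedge12 \<gamma> \<alpha> X \<in> Lam2"
  proof (rule Lam2I)
    show "wedge12 \<gamma> \<alpha> X Y Z = - wedge12 \<gamma> \<alpha> X Z Y" for Y Z
      using Lam2_anti[OF \<alpha>, of Y Z] by (simp add: wedge12_def)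
  qed (simp_all add: wedge12_def l algebra_simps)
qed

lemma pr_W_theta2_wedge12:
  assumes "linear \<gamma>" "\<alpha> \<in> Lam2"
  shows "pr_W (theta2 (wedge12 \<gamma> \<alpha>)) X = m_part (wedge12 \<gamma> \<alpha> X)"
  by (simp add: pr_W_def theta2_eq wedge12_linear wedge12_Lam2 assms pr_m_eq)

text \<open>The horizontal forms of type (1,1), that is u(2) itself; this treats
  \<open>Lam2_1\<close> and \<open>Lam2_3\<close> at once.\<close>

definition type11 :: "form2 \<Rightarrow> bool" where
  "type11 \<alpha> \<longleftrightarrow> \<alpha> \<in> Lam2 \<and> (\<forall>X Y. \<alpha> (phi0 X) (phi0 Y) = \<alpha> X Y) \<and> (\<forall>X. \<alpha> xi0 X = 0)"

lemma type11_xi0: "type11 \<alpha> \<Longrightarrow> \<alpha> X xi0 = 0"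
  using Lam2_anti[of \<alpha> X xi0] by (simp add: type11_def)

lemma Phi0_Lam2: "Phi0 \<in> Lam2"
  by (rule Lam2I) (simp_all add: Phi0_nth algebra_simps)

lemma type11_Phi0: "type11 (\<lambda>X Y. t * Phi0 X Y)"
  unfolding type11_def
  by (intro conjI Lam2I allI) (simp_all add: Phi0_nth phi0_nth xi0_def e_nth algebra_simps)

lemma type11_uminus: "type11 \<alpha> \<Longrightarrow> type11 (\<lambda>X Y. - \<alpha> X Y)"
  unfolding type11_def
  by (auto intro!: Lam2I simp: Lam2_linear) (metis Lam2_anti)

text \<open>Of the three terms of eta \<and> \<beta>, the one with \<open>eta0 X\<close> is a
  multiple of \<open>\<beta>\<close> and lies in u(2), so the projection removes it; the other two
  are mixed and lie in m.\<close>

lemma pr_W_type11: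
  assumes \<beta>: "type11 \<beta>"
  shows "pr_W (theta2 (wedge12 eta0 \<beta>)) X Y Z = eta0 Z * \<beta> X Y - eta0 Y * \<beta> X Z"
proof -
  have "\<beta> \<in> Lam2" "\<beta> (phi0 Y) (phi0 Z) = \<beta> Y Z" "\<beta> xi0 X = 0" for X Y Z
    using \<beta> by (simp_all add: type11_def)
  then show ?thesis
    by (simp add: pr_W_theta2_wedge12 linear_eta0 m_part_def wedge12_def eta0_phi0 eta0_xi0
        type11_xi0[OF \<beta>] field_simps)
qed

section \<open>Explicit form of W1 and of W3 to W7\<close>

lemma W1_form:
  assumes "A \<in> W1"
  obtains t where "A = (\<lambda>X Y Z. t * (eta0 Z * (X \<bullet> Y) - eta0 Y * (X \<bullet> Z)))"
proof -
  obtain t where "A = theta1 (\<lambda>X. t * eta0 X)"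
    using assms by (auto simp: W1_def Lam1_1_def)
  then have "A = (\<lambda>X Y Z. t * (eta0 Z * (X \<bullet> Y) - eta0 Y * (X \<bullet> Z)))"
    by (simp add: fun_eq_iff theta1_def algebra_simps)
  then show ?thesis by (rule that)
qed

lemma W3_form:
  assumes "A \<in> W3"
  obtains t where "A = (\<lambda>X Y Z. eta0 Z * (t * Phi0 X Y) - eta0 Y * (t * Phi0 X Z))"
proof -
  obtain t where A: "A = pr_W (theta2 (hodge2 (\<lambda>X Y. t * Phi0 X Y)))"
    using assms by (auto simp: W3_def Lam3_1_def Lam2_1_def)
  have "hodge2 (\<lambda>X Y. t * Phi0 X Y) X Y Z = wedge12 eta0 (\<lambda>X Y. t * Phi0 X Y) X Y Z" for X Y Z
    by (simp add: hodge2_expand minor3_def wedge12_def eta0_nth Phi0_nth e_nth algebra_simps)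
  then have hodge: "hodge2 (\<lambda>X Y. t * Phi0 X Y) = wedge12 eta0 (\<lambda>X Y. t * Phi0 X Y)"
    by (simp add: fun_eq_iff)
  have "A = (\<lambda>X Y Z. eta0 Z * (t * Phi0 X Y) - eta0 Y * (t * Phi0 X Z))"
    unfolding A hodge by (simp add: fun_eq_iff pr_W_type11[OF type11_Phi0])
  then show ?thesis by (rule that)
qed

text \<open>The Hodge condition on \<open>Lam2_3\<close> carries a minus sign, hence the witness is
  -\<alpha>. The second property, orthogonality to Phi, distinguishes \<open>W5\<close> from
  \<open>W3\<close> and is what makes the codifferential of Phi vanish.\<close>

lemma W5_form:
  assumes "A \<in> W5"
  obtains \<beta> where "type11 \<beta>" "\<beta> (e 1) (e 2) + \<beta> (e 3) (e 4) = 0"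
    "A = (\<lambda>X Y Z. eta0 Z * \<beta> X Y - eta0 Y * \<beta> X Z)"
proof -
  obtain \<alpha> where \<alpha>: "\<alpha> \<in> Lam2_3" and A: "A = pr_W (theta2 (hodge2 \<alpha>))"
    using assms by (auto simp: W5_def Lam3_3_def)
  have "type11 \<alpha>"
    using Lam2_3_Lam2 Lam2_3_type \<alpha> by (simp add: type11_def)
  then have t: "type11 (\<lambda>X Y. - \<alpha> X Y)" by (rule type11_uminus)
  have hodge: "hodge2 \<alpha> = wedge12 eta0 (\<lambda>X Y. - \<alpha> X Y)"
    using \<alpha> by (simp add: Lam2_3_def fun_eq_iff wedge12_def)
  have "A = (\<lambda>X Y Z. eta0 Z * - \<alpha> X Y - eta0 Y * - \<alpha> X Z)"
    unfolding A hodge by (simp add: fun_eq_iff pr_W_type11[OF t])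
  then show ?thesis
    by (intro that[OF t]) (simp_all add: Lam2_3_basis[OF \<alpha>])
qed

lemma W4_form:
  assumes "A \<in> W4"
  obtains \<alpha> where "\<alpha> \<in> Lam2_2" "A = wedge12 eta0 \<alpha>"
proof -
  obtain \<alpha> where \<alpha>: "\<alpha> \<in> Lam2_2" and A: "A = theta2 (hodge2 \<alpha>)"
    using assms by (auto simp: W4_def Lam3_2_def)
  have "hodge2 \<alpha> = wedge12 eta0 \<alpha>"
    using \<alpha> by (simp add: Lam2_2_def)
  then have "A = wedge12 eta0 \<alpha>"
    unfolding A by (simp add: theta2_eq wedge12_linear linear_eta0 Lam2_2_Lam2 \<alpha>)
  with \<alpha> show ?thesis by (rule that)
qed

lemma W7_form:
  assumes "A \<in> W7"
  obtains \<alpha> where "\<alpha> \<in> Lam2_2" "A = (\<lambda>X Y Z. 3 * (eta0 X * \<alpha> Y Z) - wedge12 eta0 \<alpha> X Y Z)"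
proof -
  obtain \<alpha> where \<alpha>: "\<alpha> \<in> Lam2_2" and A: "A = theta3 \<alpha>"
    using assms by (auto simp: W7_def)
  have "A = (\<lambda>X Y Z. 3 * (eta0 X * \<alpha> Y Z) - wedge12 eta0 \<alpha> X Y Z)"
    unfolding A by (simp add: fun_eq_iff theta3_def theta2_eq wedge12_linear linear_eta0
        Lam2_2_Lam2 \<alpha>)
  with \<alpha> show ?thesis by (rule that)
qed

text \<open>Such a form is eta \<and> \<beta> with \<beta> its contraction by xi, so its dual is a
  Hodge dual in four horizontal dimensions. There the dual of a 1-form is, as in Hermitian geometry,
  its twist by phi wedged with Phi.\<close>

lemma hodge2_Lam2_4:
  assumes "\<alpha> \<in> Lam2_4"
  shows "hodge2 \<alpha> = wedge12 (\<lambda>X. \<alpha> xi0 (phi0 X)) Phi0"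
proof -
  note L = Lam2_4_Lam2[OF assms]
  have g: "\<alpha> xi0 (phi0 X) = \<alpha> (e 5) (e 1) * X $ 2 - \<alpha> (e 5) (e 2) * X $ 1
      + \<alpha> (e 5) (e 3) * X $ 4 - \<alpha> (e 5) (e 4) * X $ 3" for X
    unfolding Lam2_expand[OF L, of xi0 "phi0 X"] by (simp add: xi0_def e_nth phi0_nth)
  have "hodge2 \<alpha> X Y Z = wedge12 (\<lambda>X. \<alpha> xi0 (phi0 X)) Phi0 X Y Z" for X Y Z
    unfolding hodge2_expand wedge12_def g minor3_def Phi0_nth
    by (simp add: Lam2_4_basis[OF assms]) algebra
  then show ?thesis by (simp add: fun_eq_iff)
qed

lemma Phi0_phi0: "Phi0 X (phi0 Y) = - (X \<bullet> Y) + eta0 X * eta0 Y"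
  by (simp add: Phi0_def phi0_phi0 inner_add_right inner_diff_right inner_xi0)

text \<open>The projection keeps the part of \<gamma> \<and> Phi reversed by phi in Y and Z; the
  term \<open>\<gamma> X * Phi0 Y Z\<close> is invariant and disappears.\<close>

lemma W6_form:
  assumes "A \<in> W6"
  obtains \<gamma> where "linear \<gamma>" "\<gamma> xi0 = 0"
    "A = (\<lambda>X Y Z. (\<gamma> Z * Phi0 X Y - \<gamma> Y * Phi0 X Z
       + \<gamma> (phi0 Y) * Phi0 X (phi0 Z) - \<gamma> (phi0 Z) * Phi0 X (phi0 Y)) / 2)"
proof -
  obtain \<alpha> where \<alpha>: "\<alpha> \<in> Lam2_4" and A: "A = pr_W (theta2 (hodge2 \<alpha>))"
    using assms by (auto simp: W6_def Lam3_4_def)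
  note L = Lam2_4_Lam2[OF \<alpha>]
  define \<gamma> where "\<gamma> = (\<lambda>X. \<alpha> xi0 (phi0 X))"
  have lin: "linear \<gamma>"
    unfolding \<gamma>_def by (rule linearI) (simp_all add: phi0_linear Lam2_linear[OF L])
  have xi: "\<gamma> xi0 = 0"
    by (simp add: \<gamma>_def phi0_xi0 Lam2_linear[OF L])
  have Phi: "Phi0 (phi0 X) (phi0 Y) = Phi0 X Y" "Phi0 X xi0 = 0" "Phi0 xi0 X = 0" for X Y
    by (simp_all add: Phi0_nth phi0_nth xi0_def e_nth)
  have "A = (\<lambda>X Y Z. (\<gamma> Z * Phi0 X Y - \<gamma> Y * Phi0 X Z
       + \<gamma> (phi0 Y) * Phi0 X (phi0 Z) - \<gamma> (phi0 Z) * Phi0 X (phi0 Y)) / 2)"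
    unfolding A hodge2_Lam2_4[OF \<alpha>] \<gamma>_def[symmetric]
    by (simp add: fun_eq_iff pr_W_theta2_wedge12 lin Phi0_Lam2 m_part_def wedge12_def Phi xi)
  with lin xi show ?thesis by (rule that)
qed

section \<open>Special types on W1 and on W3 to W7\<close>

lemma W6_normal:
  assumes "A \<in> W6"
  shows "normal0 A"
proof -
  obtain \<gamma> where lin: "linear \<gamma>" and xi: "\<gamma> xi0 = 0"
    and A: "A = (\<lambda>X Y Z. (\<gamma> Z * Phi0 X Y - \<gamma> Y * Phi0 X Z
       + \<gamma> (phi0 Y) * Phi0 X (phi0 Z) - \<gamma> (phi0 Z) * Phi0 X (phi0 Y)) / 2)"
    using W6_form[OF assms] .
  have \<gamma>: "\<gamma> (phi0 (phi0 X)) = - \<gamma> X" for X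
    by (simp add: phi0_phi0 xi linear_diff[OF lin] linear_neg[OF lin] linear_add[OF lin]
        linear_scale[OF lin])
  have Phi: "Phi0 (phi0 X) Y = - Phi0 X (phi0 Y)" "Phi0 X xi0 = 0" for X Y
    by (simp_all add: Phi0_nth phi0_nth xi0_def e_nth algebra_simps)
  have Phi2: "Phi0 X (phi0 (phi0 Y)) = - Phi0 X Y" for X Y
    by (simp add: Phi0_nth phi0_nth)
  have nP: "nabla_Phi0 A X Y Z = \<gamma> Y * Phi0 X (phi0 Z) - \<gamma> Z * Phi0 X (phi0 Y)
      + \<gamma> (phi0 Y) * Phi0 X Z - \<gamma> (phi0 Z) * Phi0 X Y" for X Y Z
    by (simp add: A nabla_Phi0_def \<gamma> Phi2 field_simps)
  \<comment> \<open>Hence the d eta term of \<open>normal0\<close> drops out, and the rest cancels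
    by the symmetry of Phi(X, phi Y) and the skew symmetry of Phi.\<close>
  have Axi: "A X xi0 Y = 0" for X Y
    by (simp add: A xi Phi phi0_xi0 linear_0[OF lin] Phi0_phi0 inner_xi0 eta0_xi0)
  have sym: "Phi0 X (phi0 Y) = Phi0 Y (phi0 X)" "Phi0 X Y = - Phi0 Y X" for X Y
    by (simp_all add: Phi0_nth phi0_nth)
  show ?thesis
    unfolding normal0_def nP Phi \<gamma> Phi2 Axi
  proof (intro allI, goal_cases)
    case (1 X Y Z)
    show ?case
      unfolding sym(1)[of Y X] sym(2)[of Y X] by (simp add: algebra_simps)
  qed
qed

lemma W1_normal:
  assumes "A \<in> W1"
  shows "normal0 A"
proof -
  obtain t where A: "A = (\<lambda>X Y Z. t * (eta0 Z * (X \<bullet> Y) - eta0 Y * (X \<bullet> Z)))"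
    using W1_form[OF assms] .
  have i: "phi0 X \<bullet> phi0 Y = X \<bullet> Y - eta0 Y * eta0 X" for X Y
    by (simp add: inner_5 phi0_nth eta0_nth)
  show ?thesis
    by (rule normal0I[where b = "\<lambda>X Y. t * (X \<bullet> Y)"])
      (auto simp: A i inner_xi0 algebra_simps intro!: linearI)
qed

lemma type11_normal:
  assumes "type11 \<beta>"
  shows "normal0 (\<lambda>X Y Z. eta0 Z * \<beta> X Y - eta0 Y * \<beta> X Z)"
  using assms
  by (intro normal0I[where b = \<beta>])
    (auto simp: type11_def Lam2_linear type11_xi0[OF assms] intro!: linearI)

text \<open>For type (1,1), \<beta>(X, phi Y) is symmetric in X and Y, and the terms of d Phi cancel
  in pairs.\<close>

lemma type11_closed:
  assumes \<beta>: "type11 \<beta>"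
  shows "closed_Phi0 (\<lambda>X Y Z. eta0 Z * \<beta> X Y - eta0 Y * \<beta> X Z)"
proof -
  have L: "\<beta> \<in> Lam2" and t: "\<beta> (phi0 X) (phi0 Y) = \<beta> X Y" for X Y
    using \<beta> by (simp_all add: type11_def)
  have "\<beta> X (phi0 Y) = \<beta> Y (phi0 X)" for X Y
  proof -
    have "\<beta> X (phi0 Y) = \<beta> (phi0 X) (phi0 (phi0 Y))" by (simp add: t)
    also have "\<dots> = - \<beta> (phi0 X) Y"
      by (simp add: phi0_phi0 Lam2_linear[OF L] type11_xi0[OF \<beta>])
    finally show ?thesis using Lam2_anti[OF L, of Y "phi0 X"] by simp
  qed
  then show ?thesis
    unfolding closed_Phi0_def nabla_Phi0_def by (simp add: eta0_phi0)
qed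

text \<open>One computation for \<open>W4\<close>, \<open>W5\<close> and \<open>W7\<close>: the
  trace giving delta eta vanishes because \<open>\<alpha>\<close> is skew, and delta Phi reduces to
  the contraction of \<open>\<alpha>\<close> with Phi. The coefficients (p, q) are (1, -1), (0, -1)
  and (2, 1); in the last case p = 3 - 1, since the wedge product in \<open>theta3\<close> also
  contains eta \<otimes> \<alpha>.\<close>

lemma semi_cosymplectic0I:
  assumes A: "\<And>X Y Z. A X Y Z = p * (eta0 X * \<alpha> Y Z) + q * (eta0 Y * \<alpha> X Z - eta0 Z * \<alpha> X Y)"
    and L: "\<alpha> \<in> Lam2" and xi: "\<And>X. \<alpha> xi0 X = 0" and tr: "\<alpha> (e 1) (e 2) + \<alpha> (e 3) (e 4) = 0"
  shows "semi_cosymplectic0 A"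
proof -
  have xi': "\<alpha> X (e 5) = 0" "\<alpha> (e 5) X = 0" for X
    using Lam2_anti[OF L, of X xi0] xi by (simp_all add: xi0_def)
  have tr': "\<alpha> (e 3) (e 4) = - \<alpha> (e 1) (e 2)" using tr by simp
  show ?thesis
    unfolding semi_cosymplectic0_def delta_Phi0_def delta_eta0_def nabla_Phi0_def A
    by (simp add: sum_5 phi0_basis eta0_nth e_nth xi0_def phi0_nth Lam2_linear[OF L] Lam2_self[OF L]
        Lam2_basis_anti[OF L] xi' tr' algebra_simps)
qed

lemma W4_semi_cosymplectic: "A \<in> W4 \<Longrightarrow> semi_cosymplectic0 A"
proof (erule W4_form)
  fix \<alpha> assume \<alpha>: "\<alpha> \<in> Lam2_2" and A: "A = wedge12 eta0 \<alpha>"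
  show ?thesis
    by (rule semi_cosymplectic0I[where p = 1 and q = "- 1" and \<alpha> = \<alpha>])
      (simp_all add: A wedge12_def \<alpha> Lam2_2_Lam2 Lam2_2_type[OF \<alpha>] Lam2_2_basis[OF \<alpha>])
qed

lemma W5_semi_cosymplectic: "A \<in> W5 \<Longrightarrow> semi_cosymplectic0 A"
proof (erule W5_form)
  fix \<beta> assume \<beta>: "type11 \<beta>" and tr: "\<beta> (e 1) (e 2) + \<beta> (e 3) (e 4) = 0"
    and A: "A = (\<lambda>X Y Z. eta0 Z * \<beta> X Y - eta0 Y * \<beta> X Z)"
  show ?thesis
    by (rule semi_cosymplectic0I[where p = 0 and q = "- 1" and \<alpha> = \<beta>])
      (use \<beta> tr in \<open>simp_all add: A type11_def\<close>)
qed

lemma W7_semi_cosymplectic: "A \<in> W7 \<Longrightarrow> semi_cosymplectic0 A"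
proof (erule W7_form)
  fix \<alpha> assume \<alpha>: "\<alpha> \<in> Lam2_2"
    and A: "A = (\<lambda>X Y Z. 3 * (eta0 X * \<alpha> Y Z) - wedge12 eta0 \<alpha> X Y Z)"
  show ?thesis
    by (rule semi_cosymplectic0I[where p = 2 and q = 1 and \<alpha> = \<alpha>])
      (simp_all add: A wedge12_def \<alpha> Lam2_2_Lam2 Lam2_2_type[OF \<alpha>] Lam2_2_basis[OF \<alpha>] algebra_simps)
qed

lemma W3_normal: "A \<in> W3 \<Longrightarrow> normal0 A" and W3_closed: "A \<in> W3 \<Longrightarrow> closed_Phi0 A"
  by (erule W3_form, simp only: type11_normal[OF type11_Phi0] type11_closed[OF type11_Phi0])+

lemma W5_normal: "A \<in> W5 \<Longrightarrow> normal0 A" and W5_closed: "A \<in> W5 \<Longrightarrow> closed_Phi0 A"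
  by (erule W5_form, simp only: type11_normal type11_closed)+

lemma W1_trans: "A \<in> W1 \<Longrightarrow> trans_Sasaki0 A"
proof (erule W1_form)
  fix t assume A: "A = (\<lambda>X Y Z. t * (eta0 Z * (X \<bullet> Y) - eta0 Y * (X \<bullet> Z)))"
  have nP: "nabla_Phi0 A X Y Z = t * (eta0 Y * (X \<bullet> phi0 Z) - eta0 Z * (X \<bullet> phi0 Y))" for X Y Z
    by (simp add: nabla_Phi0_def A eta0_phi0 algebra_simps)
  \<comment> \<open>Each of the four horizontal basis vectors contributes t. This is the origin of
    the factor 4 in the trans-Sasaki condition; on \<open>W3\<close> the same count yields -4t for
    delta Phi.\<close>
  have "delta_Phi0 A xi0 = 0" "delta_eta0 A = 4 * t"
    unfolding delta_Phi0_def delta_eta0_def nP unfolding A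
    by (simp_all add: sum_5 inner_5 phi0_nth eta0_nth e_nth xi0_def)
  then show ?thesis
    by (simp add: trans_Sasaki0_def nP algebra_simps)
qed

lemma W3_trans: "A \<in> W3 \<Longrightarrow> trans_Sasaki0 A"
proof (erule W3_form)
  fix t assume A: "A = (\<lambda>X Y Z. eta0 Z * (t * Phi0 X Y) - eta0 Y * (t * Phi0 X Z))"
  have nP: "nabla_Phi0 A X Y Z = t * (eta0 Z * (X \<bullet> Y) - eta0 Y * (X \<bullet> Z))" for X Y Z
    by (simp add: nabla_Phi0_def A eta0_phi0 Phi0_phi0 algebra_simps)
  have "delta_Phi0 A xi0 = - 4 * t" "delta_eta0 A = 0"
    unfolding delta_Phi0_def delta_eta0_def nP unfolding A
    by (simp_all add: sum_5 inner_5 phi0_nth eta0_nth e_nth xi0_def Phi0_nth)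
  then show ?thesis
    by (simp add: trans_Sasaki0_def nP algebra_simps)
qed

section \<open>From single summands to their sums\<close>

lemma W_simps: "W (Suc 0) = W1" "W 1 = W1" "W 3 = W3" "W 4 = W4" "W 5 = W5" "W 6 = W6"
  "W 7 = W7" "W 8 = W8"
  "W 9 = W9" "W 10 = W10"
  by (simp_all add: W_def)

lemma W_sum_induct:
  assumes "A \<in> W_sum I" "finite I" "P (\<lambda>X Y Z. 0)"
    "\<And>A B. P A \<Longrightarrow> P B \<Longrightarrow> P (\<lambda>X Y Z. A X Y Z + B X Y Z)" "\<And>i A. i \<in> I \<Longrightarrow> A \<in> W i \<Longrightarrow> P A"
  shows "P A"
proof -
  obtain B where B: "\<forall>i\<in>I. B i \<in> W i" and A: "A = (\<lambda>X Y Z. \<Sum>i\<in>I. B i X Y Z)"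
    using assms(1) by (auto simp: W_sum_def)
  have "P (\<lambda>X Y Z. \<Sum>i\<in>J. B i X Y Z)" if "J \<subseteq> I" for J
    using finite_subset[OF that assms(2)] that
  proof (induction J rule: finite_induct)
    case (insert i J)
    then have "P (\<lambda>X Y Z. B i X Y Z + (\<Sum>i\<in>J. B i X Y Z))"
      using assms(4)[of "B i"] assms(5)[of i "B i"] B by simp
    then show ?case using insert by simp
  qed (simp add: assms(3))
  then show ?thesis unfolding A by simp
qed

lemma nabla_Phi0_add:
  "nabla_Phi0 (\<lambda>X Y Z. A X Y Z + B X Y Z) X Y Z = nabla_Phi0 A X Y Z + nabla_Phi0 B X Y Z"
  "nabla_Phi0 (\<lambda>X Y Z. 0) X Y Z = 0"
  by (simp_all add: nabla_Phi0_def)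

lemma delta0_add:
  "delta_Phi0 (\<lambda>X Y Z. A X Y Z + B X Y Z) X = delta_Phi0 A X + delta_Phi0 B X"
  "delta_eta0 (\<lambda>X Y Z. A X Y Z + B X Y Z) = delta_eta0 A + delta_eta0 B"
  "delta_Phi0 (\<lambda>X Y Z. 0) X = 0" "delta_eta0 (\<lambda>X Y Z. 0) = 0"
  by (simp_all add: delta_Phi0_def delta_eta0_def nabla_Phi0_add sum.distrib)

lemma W_sum_normal:
  assumes "A \<in> W_sum I" "I \<subseteq> {1, 3, 5, 6, 8}"
  shows "normal0 A"
  using assms(1)
proof (rule W_sum_induct)
  fix A B assume AB: "normal0 A" "normal0 B"
  show "normal0 (\<lambda>X Y Z. A X Y Z + B X Y Z)"
    unfolding normal0_def nabla_Phi0_add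
  proof (intro allI)
    fix X Y Z
    show "nabla_Phi0 A (phi0 X) Z Y + nabla_Phi0 B (phi0 X) Z Y
      - (nabla_Phi0 A (phi0 Y) Z X + nabla_Phi0 B (phi0 Y) Z X)
      - (nabla_Phi0 A Y (phi0 Z) X + nabla_Phi0 B Y (phi0 Z) X)
      + (nabla_Phi0 A X (phi0 Z) Y + nabla_Phi0 B X (phi0 Z) Y)
      + (A X xi0 Y + B X xi0 Y - (A Y xi0 X + B Y xi0 X)) * eta0 Z = 0"
      using AB[unfolded normal0_def, rule_format, of X Z Y] by (simp add: algebra_simps)
  qed
next
  fix i A assume "i \<in> I" "A \<in> W i"
  then have "A \<in> W1 \<or> A \<in> W3 \<or> A \<in> W5 \<or> A \<in> W6 \<or> A \<in> W8"
    using assms(2) by (auto simp: W_simps)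
  then show "normal0 A"
    using W1_normal W3_normal W5_normal W6_normal W8_normal by blast
qed (use assms(2) in \<open>auto simp: finite_subset normal0_def nabla_Phi0_add\<close>)

lemma W_sum_closed_Phi0:
  assumes "A \<in> W_sum I" "I \<subseteq> {3, 5, 9, 10}"
  shows "closed_Phi0 A"
  using assms(1)
proof (rule W_sum_induct)
  fix A B assume AB: "closed_Phi0 A" "closed_Phi0 B"
  then show "closed_Phi0 (\<lambda>X Y Z. A X Y Z + B X Y Z)"
    unfolding closed_Phi0_def nabla_Phi0_add by (smt (verit))
next
  fix i A assume "i \<in> I" "A \<in> W i"
  then have "A \<in> W3 \<or> A \<in> W5 \<or> A \<in> W9 \<or> A \<in> W10"
    using assms(2) by (auto simp: W_simps)
  then show "closed_Phi0 A"
    using W3_closed W5_closed W9_closed W10_closed by blast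
qed (use assms(2) in \<open>auto simp: finite_subset closed_Phi0_def nabla_Phi0_add\<close>)

lemma W_sum_closed_eta0:
  assumes "A \<in> W_sum {9, 10}"
  shows "closed_eta0 A"
  using assms
proof (rule W_sum_induct)
  fix A B assume "closed_eta0 A" "closed_eta0 B"
  then show "closed_eta0 (\<lambda>X Y Z. A X Y Z + B X Y Z)"
    by (simp add: closed_eta0_def)
qed (use W9_closed W10_closed in \<open>auto simp: W_simps closed_eta0_def\<close>)

lemma W_sum_quasi_cosymplectic:
  assumes "A \<in> W_sum {9, 10}"
  shows "quasi_cosymplectic0 A"
  using assms
proof (rule W_sum_induct)
  fix A B assume AB: "quasi_cosymplectic0 A" "quasi_cosymplectic0 B"
  show "quasi_cosymplectic0 (\<lambda>X Y Z. A X Y Z + B X Y Z)"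
    unfolding quasi_cosymplectic0_def nabla_Phi0_add
  proof (intro allI)
    fix X Y Z
    show "nabla_Phi0 A X Z Y + nabla_Phi0 B X Z Y
      + (nabla_Phi0 A (phi0 X) Z (phi0 Y) + nabla_Phi0 B (phi0 X) Z (phi0 Y))
      = eta0 Y * (A (phi0 X) xi0 Z + B (phi0 X) xi0 Z)"
      using AB[unfolded quasi_cosymplectic0_def, rule_format, of X Z Y] by (simp add: algebra_simps)
  qed
next
  fix i A assume "i \<in> {9 :: nat, 10}" "A \<in> W i"
  then show "quasi_cosymplectic0 A"
    using W9_quasi_cosymplectic W10_quasi_cosymplectic by (auto simp: W_simps)
qed (auto simp: quasi_cosymplectic0_def nabla_Phi0_add)

lemma W_sum_semi_cosymplectic:
  assumes "A \<in> W_sum {4, 5, 7, 8, 9, 10}"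
  shows "semi_cosymplectic0 A"
  using assms
proof (rule W_sum_induct)
  fix i A assume "i \<in> {4 :: nat, 5, 7, 8, 9, 10}" "A \<in> W i"
  then show "semi_cosymplectic0 A"
    using W4_semi_cosymplectic W5_semi_cosymplectic W7_semi_cosymplectic W8_semi_cosymplectic
      W9_semi_cosymplectic W10_semi_cosymplectic by (auto simp: W_simps)
qed (auto simp: semi_cosymplectic0_def delta0_add)

lemma W_sum_trans_Sasaki:
  assumes "A \<in> W_sum {1, 3}"
  shows "trans_Sasaki0 A"
  using assms
proof (rule W_sum_induct)
  fix A B assume AB: "trans_Sasaki0 A" "trans_Sasaki0 B"
  show "trans_Sasaki0 (\<lambda>X Y Z. A X Y Z + B X Y Z)"
    unfolding trans_Sasaki0_def nabla_Phi0_add delta0_add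
  proof (intro allI)
    fix X Y Z
    show "4 * (nabla_Phi0 A X Y Z + nabla_Phi0 B X Y Z)
     = ((delta_Phi0 A xi0 + delta_Phi0 B xi0) * (X \<bullet> Z)
         + (delta_eta0 A + delta_eta0 B) * (X \<bullet> phi0 Z)) * eta0 Y
       - ((delta_Phi0 A xi0 + delta_Phi0 B xi0) * (X \<bullet> Y)
         + (delta_eta0 A + delta_eta0 B) * (X \<bullet> phi0 Y)) * eta0 Z"
      using AB[unfolded trans_Sasaki0_def, rule_format, of X Y Z] by (simp add: algebra_simps)
  qed
next
  fix i A assume "i \<in> {1 :: nat, 3}" "A \<in> W i"
  then show "trans_Sasaki0 A"
    using W1_trans W3_trans by (auto simp: W_simps)
qed (auto simp: trans_Sasaki0_def nabla_Phi0_add delta0_add)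

section \<open>Geometry in an adapted frame\<close>

lemma smooth_on_differentiable:
  assumes "smooth_on S f" "open S" "x \<in> S"
  shows "f differentiable at x"
proof -
  have "Ck_on (Suc 0) S f"
    using assms(1) by (simp only: smooth_on_def)
  then have "f differentiable_on S" by simp
  then show ?thesis
    using assms(2,3) by (simp add: differentiable_on_eq_differentiable_at)
qed

lemma bilinear_basis_sum:
  assumes "bilinear h"
  shows "(\<Sum>i\<in>UNIV. \<Sum>j\<in>UNIV. X $ i * Y $ j * h (e i) (e j)) = (h X Y :: real)"
proof -
  have l: "linear (h X)" "linear (\<lambda>X. h X Y)" for X Y
    using assms by (simp_all add: bilinear_def)
  have d: "dual (e i) X = X $ i" for i X
    by (simp add: dual_def e_def inner_commute[of "axis _ _"] inner_axis)
  have "(\<Sum>i\<in>UNIV. \<Sum>j\<in>UNIV. X $ i * Y $ j * h (e i) (e j))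
      = (\<Sum>i\<in>UNIV. X $ i * (\<Sum>j\<in>UNIV. Y $ j * h (e i) (e j)))"
    by (simp add: sum_distrib_left mult.assoc)
  also have "\<dots> = h X Y"
    using linear_basis_sum[OF l(1), unfolded d] linear_basis_sum[OF l(2), unfolded d] by simp
  finally show ?thesis .
qed

text \<open>One point of one chart with a frame around it. Identities that get differentiated at
  \<open>x\<close> are assumed on the whole neighbourhood \<open>U\<close>; positivity and
  differentiability are stated at \<open>x\<close>.\<close>

locale almost_contact_frame =
  fixes g :: metric and \<xi> :: vfield and \<eta> :: field1 and \<phi> :: endo
    and U :: "vec5 set" and E :: "5 \<Rightarrow> vfield" and x :: vec5
  assumes open_U: "open U" and x_U: "x \<in> U"
    and g_diff: "\<And>u v. (\<lambda>y. g y u v) differentiable at x"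
    and g_bil: "\<And>y. y \<in> U \<Longrightarrow> bilinear (g y)"
    and g_sym: "\<And>y u v. y \<in> U \<Longrightarrow> g y u v = g y v u"
    and g_pos: "\<And>u. u \<noteq> 0 \<Longrightarrow> g x u u > 0"
    and phi_diff: "\<And>v. (\<lambda>y. \<phi> y v) differentiable at x"
    and phi_lin: "\<And>y. y \<in> U \<Longrightarrow> linear (\<phi> y)"
    and eta_eq: "\<And>y v. y \<in> U \<Longrightarrow> \<eta> y v = g y (\<xi> y) v"
    and frame: "adapted_frame g \<xi> \<phi> U E"
begin

section \<open>The Levi-Civita connection at the point\<close>

abbreviation "C \<equiv> christoffel g x"

lemma levi_civita: "levi_civita_at g x C"
  using theI'[OF ex1_christoffel[OF open_U x_U g_bil g_sym g_pos g_diff]]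
  by (simp add: christoffel_def)

lemma C_bil: "bilinear C" and C_sym: "C u v = C v u"
  and g_frechet: "frechet_derivative (\<lambda>y. g y v w) (at x) u = g x (C u v) w + g x v (C u w)"
  using levi_civita unfolding levi_civita_at_def by blast+

lemmas C_linear = bilinear_ladd[OF C_bil] bilinear_radd[OF C_bil] bilinear_lmul[OF C_bil]
  bilinear_rmul[OF C_bil]

lemmas g_x_bil = g_bil[OF x_U]

lemmas g_linear = bilinear_ladd[OF g_x_bil] bilinear_radd[OF g_x_bil] bilinear_lmul[OF g_x_bil]
  bilinear_rmul[OF g_x_bil] bilinear_lsub[OF g_x_bil] bilinear_rsub[OF g_x_bil]
  bilinear_lneg[OF g_x_bil] bilinear_rneg[OF g_x_bil] bilinear_lzero[OF g_x_bil]
  bilinear_rzero[OF g_x_bil]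

lemmas phi_linear = linear_add[OF phi_lin[OF x_U]] linear_scale[OF phi_lin[OF x_U]]
  linear_diff[OF phi_lin[OF x_U]] linear_neg[OF phi_lin[OF x_U]]

lemma g_nondegenerate:
  assumes "\<And>w. g x w a = g x w b"
  shows "a = b"
proof (rule ccontr)
  assume "a \<noteq> b"
  then have "g x (a - b) (a - b) > 0" using g_pos[of "a - b"] by simp
  moreover have "g x (a - b) (a - b) = 0" using assms[of "a - b"] by (simp add: g_linear(6))
  ultimately show False by simp
qed

lemma g_has_derivative:
  "((\<lambda>y. g y v w) has_derivative (\<lambda>u. g x (C u v) w + g x v (C u w))) (at x)"
proof -
  have "frechet_derivative (\<lambda>y. g y v w) (at x) = (\<lambda>u. g x (C u v) w + g x v (C u w))"
    by (rule ext) (rule g_frechet)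
  then show ?thesis
    using g_diff[of v w] unfolding frechet_derivative_works by simp
qed

lemma nth_has_derivative:
  assumes "Y differentiable at x"
  shows "((\<lambda>y. Y y $ i) has_derivative (\<lambda>u. frechet_derivative Y (at x) u $ i)) (at x)"
  using bounded_linear.has_derivative[OF bounded_linear_vec_nth assms[unfolded frechet_derivative_works]]
  by simp

text \<open>\<open>levi_civita_at\<close> states compatibility with the metric for constant
  coefficients only. Expanding Y and Z in the coordinate basis and using the product rule extends it
  to fields differentiable at \<open>x\<close>.\<close>

lemma metric_connection:
  assumes Y: "Y differentiable at x" and Z: "Z differentiable at x"
  shows "((\<lambda>y. g y (Y y) (Z y)) has_derivative
    (\<lambda>u. g x (nabla g Y x u) (Z x) + g x (Y x) (nabla g Z x u))) (at x)"
proof -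
  define Y' where "Y' = frechet_derivative Y (at x)"
  define Z' where "Z' = frechet_derivative Z (at x)"
  have h: "bilinear (\<lambda>a b. g x (C u a) b + g x a (C u b))" for u
    unfolding bilinear_def by (intro conjI allI linearI) (simp_all add: g_linear C_linear algebra_simps)
  have "((\<lambda>y. \<Sum>i\<in>UNIV. \<Sum>j\<in>UNIV. Y y $ i * Z y $ j * g y (e i) (e j)) has_derivative
    (\<lambda>u. \<Sum>i\<in>UNIV. \<Sum>j\<in>UNIV. Y x $ i * Z x $ j * (g x (C u (e i)) (e j) + g x (e i) (C u (e j)))
       + (Y x $ i * Z' u $ j + Y' u $ i * Z x $ j) * g x (e i) (e j))) (at x)"
    unfolding Y'_def Z'_def
    by (intro has_derivative_sum has_derivative_mult nth_has_derivative Y Z g_has_derivative)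
  also have "(\<lambda>u. \<Sum>i\<in>UNIV. \<Sum>j\<in>UNIV. Y x $ i * Z x $ j * (g x (C u (e i)) (e j) + g x (e i) (C u (e j)))
       + (Y x $ i * Z' u $ j + Y' u $ i * Z x $ j) * g x (e i) (e j))
    = (\<lambda>u. g x (nabla g Y x u) (Z x) + g x (Y x) (nabla g Z x u))"
  proof
    fix u
    have "(\<Sum>i\<in>UNIV. \<Sum>j\<in>UNIV. Y x $ i * Z x $ j * (g x (C u (e i)) (e j) + g x (e i) (C u (e j)))
       + (Y x $ i * Z' u $ j + Y' u $ i * Z x $ j) * g x (e i) (e j))
      = (\<Sum>i\<in>UNIV. \<Sum>j\<in>UNIV. Y x $ i * Z x $ j * (g x (C u (e i)) (e j) + g x (e i) (C u (e j))))
       + ((\<Sum>i\<in>UNIV. \<Sum>j\<in>UNIV. Y x $ i * Z' u $ j * g x (e i) (e j))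
         + (\<Sum>i\<in>UNIV. \<Sum>j\<in>UNIV. Y' u $ i * Z x $ j * g x (e i) (e j)))"
      by (simp only: sum.distrib distrib_right)
    also have "\<dots> = g x (nabla g Y x u) (Z x) + g x (Y x) (nabla g Z x u)"
      unfolding bilinear_basis_sum[OF h] bilinear_basis_sum[OF g_x_bil]
      by (simp add: nabla_def Y'_def Z'_def g_linear)
    finally show "(\<Sum>i\<in>UNIV. \<Sum>j\<in>UNIV. Y x $ i * Z x $ j * (g x (C u (e i)) (e j) + g x (e i) (C u (e j)))
       + (Y x $ i * Z' u $ j + Y' u $ i * Z x $ j) * g x (e i) (e j))
      = g x (nabla g Y x u) (Z x) + g x (Y x) (nabla g Z x u)" .
  qed
  finally show ?thesis
    by (rule has_derivative_transform_within_open[OF _ open_U x_U])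
      (rule bilinear_basis_sum[OF g_bil])
qed

lemma nabla_const: "nabla g (\<lambda>y. v) x u = C u v"
  by (simp add: nabla_def)

lemma frechet_derivative_eqI: "(f has_derivative f') (at x) \<Longrightarrow> frechet_derivative f (at x) u = f' u"
  using frechet_derivative_at by metis

lemma g_field_has_derivative:
  assumes "Y differentiable at x"
  shows "((\<lambda>y. g y (Y y) v) has_derivative (\<lambda>u. g x (nabla g Y x u) v + g x (Y x) (C u v))) (at x)"
  using metric_connection[OF assms, of "\<lambda>y. v"] by (simp add: nabla_const)

lemma E_diff: "E i differentiable at x"
  using frame smooth_on_differentiable[OF _ open_U x_U] unfolding adapted_frame_def by blast

lemma E_orthonormal: "y \<in> U \<Longrightarrow> g y (E i y) (E j y) = (if i = j then 1 else 0)"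
  and E_5: "y \<in> U \<Longrightarrow> E 5 y = \<xi> y"
  and Phi_E: "y \<in> U \<Longrightarrow> Phi g \<phi> y u v =
    wedge11 (g y (E 1 y)) (g y (E 2 y)) u v + wedge11 (g y (E 3 y)) (g y (E 4 y)) u v"
  using frame unfolding adapted_frame_def orthonormal_at_def by blast+

lemma nabla_xi: "nabla g \<xi> x u = nabla g (E 5) x u"
  unfolding nabla_def
  using frechet_derivative_transform_within_open[OF E_diff open_U x_U E_5] E_5[OF x_U] by simp

lemma nabla_eta: "nabla_form1 g \<eta> x u v = g x (nabla g \<xi> x u) v"
proof -
  have "((\<lambda>y. \<eta> y v) has_derivative (\<lambda>u. g x (nabla g (E 5) x u) v + g x (E 5 x) (C u v))) (at x)"
    by (rule has_derivative_transform_within_open[OF g_field_has_derivative[OF E_diff] open_U x_U])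
      (simp add: eta_eq E_5)
  then show ?thesis
    by (simp add: nabla_form1_def frechet_derivative_eqI nabla_const nabla_xi eta_eq x_U E_5)
qed

section \<open>Connection coefficients of the frame and the derivative of phi\<close>

definition omega :: "vec5 \<Rightarrow> 5 \<Rightarrow> 5 \<Rightarrow> real" where
  "omega u i j = g x (nabla g (E i) x u) (E j x)"

lemma omega_anti: "omega u i j = - omega u j i"
proof -
  have "((\<lambda>y. g y (E i y) (E j y)) has_derivative (\<lambda>u. 0)) (at x)"
    by (rule has_derivative_transform_within_open[OF has_derivative_const open_U x_U])
      (simp add: E_orthonormal)
  then have "(\<lambda>u. g x (nabla g (E i) x u) (E j x) + g x (E i x) (nabla g (E j) x u)) = (\<lambda>u. 0)"
    using metric_connection[OF E_diff E_diff] by (rule has_derivative_unique[rotated])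
  then have "g x (nabla g (E i) x u) (E j x) + g x (E i x) (nabla g (E j) x u) = 0"
    by metis
  then show ?thesis
    by (simp add: omega_def g_sym[OF x_U, of "E i x"])
qed

lemma nabla_add: "Y differentiable at x \<Longrightarrow> nabla g Y x (u + v) = nabla g Y x u + nabla g Y x v"
  and nabla_scale: "Y differentiable at x \<Longrightarrow> nabla g Y x (r *\<^sub>R u) = r *\<^sub>R nabla g Y x u"
  using linear_add[OF linear_frechet_derivative] linear_scale[OF linear_frechet_derivative]
  by (simp_all add: nabla_def C_linear scaleR_add_right)

lemma nabla_endo_add: "nabla_endo g \<phi> x (u + v) w = nabla_endo g \<phi> x u w + nabla_endo g \<phi> x v w"
  and nabla_endo_scale: "nabla_endo g \<phi> x (r *\<^sub>R u) w = r *\<^sub>R nabla_endo g \<phi> x u w"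
  by (simp_all add: nabla_endo_def nabla_const nabla_add nabla_scale phi_diff C_linear phi_linear
      scaleR_diff_right)

lemma nabla_Phi: "nabla_form2 g (Phi g \<phi>) x u v w = g x v (nabla_endo g \<phi> x u w)"
proof -
  have "((\<lambda>y. g y v (\<phi> y w)) has_derivative
     (\<lambda>u. g x (C u v) (\<phi> x w) + g x v (nabla g (\<lambda>y. \<phi> y w) x u))) (at x)"
    using metric_connection[OF differentiable_const phi_diff, of v w] by (simp add: nabla_const)
  then show ?thesis
    unfolding nabla_form2_def Phi_def by (simp add: frechet_derivative_eqI nabla_const
        nabla_endo_def g_linear)
qed

section \<open>The isometry from the local model to the tangent space\<close>

definition iota :: "vec5 \<Rightarrow> vec5" where
  "iota X = (\<Sum>k\<in>UNIV. X $ k *\<^sub>R E k x)"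

lemma iota_linear: "linear iota"
  by (rule linearI) (simp_all add: iota_def scaleR_add_left sum.distrib scaleR_sum_right)

lemma iota_e: "iota (e i) = E i x"
proof -
  have "iota (e i) = (\<Sum>k\<in>UNIV. if k = i then E k x else 0)"
    unfolding iota_def by (rule sum.cong) (auto simp: e_nth)
  then show ?thesis by simp
qed

lemma g_E_iota: "g x (E i x) (iota X) = X $ i"
proof -
  have "linear (g x (E i x))" using g_x_bil by (simp add: bilinear_def)
  then have "g x (E i x) (iota X) = (\<Sum>k\<in>UNIV. X $ k * g x (E i x) (E k x))"
    unfolding iota_def by (simp add: linear_sum linear_scale)
  then show ?thesis by (simp add: E_orthonormal[OF x_U] if_distrib cong: if_cong)
qed

lemma g_iota_sum: "g x (iota X) v = (\<Sum>k\<in>UNIV. X $ k * g x (E k x) v)"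
proof -
  have l: "linear (\<lambda>u. g x u v)" using g_x_bil by (simp add: bilinear_def)
  show ?thesis
    unfolding iota_def by (simp add: linear_sum[OF l] linear_scale[OF l])
qed

lemma g_iota: "g x (iota X) (iota Y) = X \<bullet> Y"
  unfolding g_iota_sum g_E_iota by (simp add: inner_vec_def)

lemma iota_surj: obtains X where "v = iota X"
proof -
  have "inj iota"
  proof (rule injI)
    fix X Y assume "iota X = iota Y"
    then have "X $ i = Y $ i" for i using g_E_iota by metis
    then show "X = Y" by (simp add: vec_eq_iff)
  qed
  then have "surj iota" using linear_injective_imp_surjective[OF iota_linear] by simp
  then show ?thesis using that by (metis surjD)
qed

lemma xi_iota: "\<xi> x = iota xi0"
  by (simp add: xi0_def iota_e E_5 x_U)

lemma eta_iota: "\<eta> x (iota X) = eta0 X"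
  by (simp add: eta_eq x_U xi_iota g_iota inner_xi0)

text \<open>An adapted frame prescribes Phi, not phi; pairing with arbitrary vectors recovers phi
  because g is nondegenerate.\<close>

lemma phi_iota: "\<phi> x (iota X) = iota (phi0 X)"
proof (rule g_nondegenerate)
  fix w
  obtain Z where w: "w = iota Z" by (rule iota_surj)
  show "g x w (\<phi> x (iota X)) = g x w (iota (phi0 X))"
    unfolding w g_iota using Phi_E[OF x_U, of "iota Z" "iota X"]
    by (simp add: Phi_def wedge11_def g_E_iota inner_5 phi0_nth algebra_simps)
qed

section \<open>Connection form and intrinsic torsion\<close>

abbreviation "Omega \<equiv> connection_form g E x"

lemma Omega_expand: "Omega X Y Z =
  (\<Sum>(i, j) | i < j. omega (iota X) i j * (Y $ i * Z $ j - Y $ j * Z $ i))"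
  unfolding connection_form_def iota_def[symmetric] omega_def[symmetric]
  by (simp add: wedge11_def dual_def e_def inner_commute[of "axis _ _"] inner_axis mult.commute)

lemma Omega_Lam2: "Omega X \<in> Lam2"
  unfolding Omega_expand[abs_def] sum_pairs_5
  by (rule Lam2I) (simp_all add: algebra_simps)

lemma g_nabla_iota: "g x (nabla g (E i) x u) (iota Z) = (\<Sum>j\<in>UNIV. Z $ j * omega u i j)"
proof -
  have l: "linear (g x v)" for v using g_x_bil by (simp add: bilinear_def)
  show ?thesis
    unfolding iota_def omega_def by (simp add: linear_sum[OF l] linear_scale[OF l])
qed

text \<open>Skew symmetry of \<open>omega\<close> turns the sum over pairs i < j into a full double
  sum, which makes the contraction with a frame vector readable.\<close>

lemma Omega_sum: "Omega X Y Z = (\<Sum>i\<in>UNIV. Y $ i * g x (nabla g (E i) x (iota X)) (iota Z))"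
proof -
  note w = omega_anti[of "iota X"]
  have w0: "omega (iota X) i i = 0" for i using w[of i i] by simp
  show ?thesis
    unfolding Omega_expand sum_pairs_5 g_nabla_iota sum_5
    unfolding w[of 1 5] w[of 2 5] w[of 3 5] w[of 4 5] w[of 2 1] w[of 3 1] w[of 4 1] w[of 3 2]
      w[of 4 2] w[of 4 3] w0
    by algebra
qed

lemma Omega_e: "Omega X (e i) Z = g x (nabla g (E i) x (iota X)) (iota Z)"
proof -
  have "Omega X (e i) Z = (\<Sum>k\<in>UNIV. if k = i then g x (nabla g (E k) x (iota X)) (iota Z) else 0)"
    unfolding Omega_sum by (rule sum.cong) (auto simp: e_nth)
  then show ?thesis by simp
qed

lemma nabla_xi_Omega: "g x (nabla g \<xi> x (iota X)) (iota Y) = Omega X xi0 Y"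
  by (simp add: nabla_xi xi0_def Omega_e)

lemma nabla_Phi_Omega:
  "nabla_form2 g (Phi g \<phi>) x (iota X) (iota Y) (iota Z) = nabla_Phi0 Omega X Y Z"
proof -
  \<comment> \<open>\<open>a i\<close> is the coframe and \<open>n i\<close> the derivative of
    \<open>E i\<close> as a 1-form. Phi has constant coefficients in the products of the
    \<open>a i\<close>, and the Christoffel terms that arise on differentiating are exactly those
    subtracted in \<open>nabla_form2\<close>; only the \<open>n i\<close> survive.\<close>
  define a where "a i v y = g y (E i y) v" for i v y
  define n where "n i u v = g x (nabla g (E i) x u) v" for i u v
  have a': "(a i v has_derivative (\<lambda>u. n i u v + a i (C u v) x)) (at x)" for i v
    unfolding a_def n_def by (rule g_field_has_derivative[OF E_diff])
  have "((\<lambda>y. a 1 v y * a 2 w y - a 1 w y * a 2 v y + (a 3 v y * a 4 w y - a 3 w y * a 4 v y))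
      has_derivative
      (\<lambda>u. a 1 v x * (n 2 u w + a 2 (C u w) x) + (n 1 u v + a 1 (C u v) x) * a 2 w x
        - (a 1 w x * (n 2 u v + a 2 (C u v) x) + (n 1 u w + a 1 (C u w) x) * a 2 v x)
        + (a 3 v x * (n 4 u w + a 4 (C u w) x) + (n 3 u v + a 3 (C u v) x) * a 4 w x
        - (a 3 w x * (n 4 u v + a 4 (C u v) x) + (n 3 u w + a 3 (C u w) x) * a 4 v x)))) (at x)" for v w
    by (intro has_derivative_add has_derivative_diff has_derivative_mult a')
  then have "((\<lambda>y. Phi g \<phi> y v w)
      has_derivative
      (\<lambda>u. a 1 v x * (n 2 u w + a 2 (C u w) x) + (n 1 u v + a 1 (C u v) x) * a 2 w x
        - (a 1 w x * (n 2 u v + a 2 (C u v) x) + (n 1 u w + a 1 (C u w) x) * a 2 v x)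
        + (a 3 v x * (n 4 u w + a 4 (C u w) x) + (n 3 u v + a 3 (C u v) x) * a 4 w x
        - (a 3 w x * (n 4 u v + a 4 (C u v) x) + (n 3 u w + a 3 (C u w) x) * a 4 v x)))) (at x)" for v w
    by (rule has_derivative_transform_within_open[OF _ open_U x_U]) (simp add: Phi_E wedge11_def a_def)
  from frechet_derivative_eqI[OF this]
  have form: "nabla_form2 g (Phi g \<phi>) x u v w
      = a 1 v x * n 2 u w + n 1 u v * a 2 w x - a 1 w x * n 2 u v - n 1 u w * a 2 v x
        + a 3 v x * n 4 u w + n 3 u v * a 4 w x - a 3 w x * n 4 u v - n 3 u w * a 4 v x" for u v w
    unfolding nabla_form2_def nabla_const Phi_E[OF x_U]
    by (simp add: wedge11_def a_def[symmetric] algebra_simps)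
  have turn: "Omega X (phi0 Y) Z = Y $ 2 * n 1 (iota X) (iota Z) - Y $ 1 * n 2 (iota X) (iota Z)
      + Y $ 4 * n 3 (iota X) (iota Z) - Y $ 3 * n 4 (iota X) (iota Z)" for Y Z
    unfolding Omega_sum sum_5 n_def by (simp add: phi0_nth)
  have a: "a i (iota Y) x = Y $ i" for i Y
    by (simp add: a_def g_E_iota)
  show ?thesis
    unfolding nabla_Phi0_def Lam2_anti[OF Omega_Lam2, of X Y "phi0 Z"] form turn a
    by (simp add: algebra_simps)
qed

abbreviation "A \<equiv> intrinsic_torsion g E x"

lemma torsion_eq: "A X = m_part (Omega X)"
  by (simp add: intrinsic_torsion_def pr_m_eq Omega_Lam2)

lemma torsion_xi0: "A X xi0 Y = Omega X xi0 Y"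
  by (simp add: torsion_eq m_part_def phi0_xi0 eta0_xi0 Lam2_linear[OF Omega_Lam2]
      Lam2_self[OF Omega_Lam2])

lemma nabla_Phi0_torsion: "nabla_Phi0 A X Y Z = nabla_Phi0 Omega X Y Z"
  by (simp add: nabla_Phi0_def torsion_eq m_part_def phi0_phi0 eta0_phi0
      Lam2_linear[OF Omega_Lam2] field_simps)

lemma nabla_xi_torsion: "g x (nabla g \<xi> x (iota X)) (iota Y) = A X xi0 Y"
  by (simp add: torsion_xi0 nabla_xi_Omega)

lemma nabla_Phi_torsion:
  "nabla_form2 g (Phi g \<phi>) x (iota X) (iota Y) (iota Z) = nabla_Phi0 A X Y Z"
  by (simp add: nabla_Phi0_torsion nabla_Phi_Omega)

lemma nabla_phi_torsion: "g x (iota Z) (nabla_endo g \<phi> x (iota X) (iota Y)) = nabla_Phi0 A X Z Y"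
  using nabla_Phi_torsion[of X Z Y] by (simp add: nabla_Phi)


section \<open>Orthonormal bases, exterior derivatives and codifferentials\<close>

lemma orthonormal_expand:
  assumes b: "orthonormal_at g x b"
  shows "v = (\<Sum>i\<in>UNIV. g x (b i) v *\<^sub>R b i)"
proof -
  define j where "j X = (\<Sum>k\<in>UNIV. X $ k *\<^sub>R b k)" for X :: vec5
  have l: "linear (g x u)" for u using g_x_bil by (simp add: bilinear_def)
  have gb: "g x (b i) (b k) = (if i = k then 1 else 0)" for i k
    using b unfolding orthonormal_at_def by blast
  have gj: "g x (b i) (j X) = X $ i" for i X
    unfolding j_def by (simp add: linear_sum[OF l] linear_scale[OF l] gb if_distrib cong: if_cong)
  have "linear j"
    by (rule linearI) (simp_all add: j_def scaleR_add_left sum.distrib scaleR_sum_right)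
  moreover have "inj j"
  proof (rule injI)
    fix X Y assume "j X = j Y"
    then have "X $ i = Y $ i" for i using gj by metis
    then show "X = Y" by (simp add: vec_eq_iff)
  qed
  ultimately have "surj j" using linear_injective_imp_surjective by blast
  then obtain X where "v = j X" by (metis surjD)
  then show ?thesis using gj by (simp add: j_def)
qed

lemma onb_orthonormal: "orthonormal_at g x (onb g x)"
proof -
  have "orthonormal_at g x (\<lambda>i. E i x)"
    using E_orthonormal[OF x_U] by (simp add: orthonormal_at_def)
  from someI[of "orthonormal_at g x", OF this] show ?thesis by (simp add: onb_def)
qed

lemma onb_sum:
  assumes "linear f"
  shows "(\<Sum>i\<in>UNIV. g x (onb g x i) v * f (onb g x i)) = (f v :: real)"
proof -
  have "f v = f (\<Sum>i\<in>UNIV. g x (onb g x i) v *\<^sub>R onb g x i)"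
    using orthonormal_expand[OF onb_orthonormal, of v] by simp
  then show ?thesis by (simp add: linear_sum[OF assms] linear_scale[OF assms])
qed

text \<open>The codifferentials use an arbitrarily chosen orthonormal basis. Expanding the second
  argument in the frame and exchanging the sums shows that the trace may be taken in the frame
  instead.\<close>

lemma onb_trace:
  assumes "bilinear f"
  shows "(\<Sum>i\<in>UNIV. f (onb g x i) (onb g x i)) = (\<Sum>i\<in>UNIV. f (E i x) (E i x) :: real)"
proof -
  have l: "linear (f v)" "linear (\<lambda>v. f v w)" for v w using assms by (simp_all add: bilinear_def)
  have E: "v = (\<Sum>j\<in>UNIV. g x (E j x) v *\<^sub>R E j x)" for v
    by (rule orthonormal_expand) (simp add: orthonormal_at_def E_orthonormal[OF x_U])
  have "f v v = (\<Sum>j\<in>UNIV. g x v (E j x) * f v (E j x))" for v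
  proof -
    have "f v v = f v (\<Sum>j\<in>UNIV. g x (E j x) v *\<^sub>R E j x)" using E[of v] by simp
    then show ?thesis by (simp add: linear_sum[OF l(1)] linear_scale[OF l(1)] g_sym[OF x_U, of v])
  qed
  then have "(\<Sum>i\<in>UNIV. f (onb g x i) (onb g x i))
      = (\<Sum>i\<in>UNIV. \<Sum>j\<in>UNIV. g x (onb g x i) (E j x) * f (onb g x i) (E j x))" by simp
  also have "\<dots> = (\<Sum>j\<in>UNIV. \<Sum>i\<in>UNIV. g x (onb g x i) (E j x) * f (onb g x i) (E j x))"
    by (rule sum.swap)
  also have "\<dots> = (\<Sum>j\<in>UNIV. f (E j x) (E j x))"
    by (simp add: onb_sum[OF l(2)])
  finally show ?thesis .
qed

lemma xi_diff: "\<xi> differentiable at x"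
proof -
  have "(\<xi> has_derivative frechet_derivative (E 5) (at x)) (at x)"
    by (rule has_derivative_transform_within_open[OF _ open_U x_U E_5])
      (use E_diff frechet_derivative_works in blast)+
  then show ?thesis unfolding differentiable_def by blast
qed

lemma nabla_form1_bilinear: "bilinear (nabla_form1 g \<eta> x)"
  unfolding bilinear_def
  by (intro conjI allI linearI) (simp_all add: nabla_eta nabla_add nabla_scale xi_diff g_linear)

lemma nabla_form2_bilinear: "bilinear (\<lambda>u v. nabla_form2 g (Phi g \<phi>) x u v w)"
  unfolding bilinear_def
  by (intro conjI allI linearI) (simp_all add: nabla_Phi nabla_endo_add nabla_endo_scale g_linear)

lemma d_eta: "d_form1 g \<eta> x u v = nabla_form1 g \<eta> x u v - nabla_form1 g \<eta> x v u"
proof -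
  have l: "linear (\<lambda>u. nabla_form1 g \<eta> x u v)" for v
    using nabla_form1_bilinear by (simp add: bilinear_def)
  show ?thesis
    unfolding d_form1_def wedge11_def by (simp add: sum_subtractf onb_sum[OF l])
qed

lemma d_Phi: "d_form2 g (Phi g \<phi>) x u v w = nabla_form2 g (Phi g \<phi>) x u v w
    - nabla_form2 g (Phi g \<phi>) x v u w + nabla_form2 g (Phi g \<phi>) x w u v"
proof -
  have l: "linear (\<lambda>u. nabla_form2 g (Phi g \<phi>) x u v w)" for v w
    using nabla_form2_bilinear by (simp add: bilinear_def)
  show ?thesis
    unfolding d_form2_def wedge12_def by (simp add: sum_subtractf sum.distrib onb_sum[OF l])
qed

lemma d_eta_torsion: "d_form1 g \<eta> x (iota X) (iota Y) = A X xi0 Y - A Y xi0 X"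
  by (simp add: d_eta nabla_eta nabla_xi_torsion)

lemma d_Phi_torsion: "d_form2 g (Phi g \<phi>) x (iota X) (iota Y) (iota Z)
    = nabla_Phi0 A X Y Z - nabla_Phi0 A Y X Z + nabla_Phi0 A Z X Y"
  by (simp add: d_Phi nabla_Phi_torsion)

lemma delta_eta_torsion: "delta_form1 g \<eta> x = delta_eta0 A"
  unfolding delta_form1_def delta_eta0_def onb_trace[OF nabla_form1_bilinear]
  by (simp add: iota_e[symmetric] nabla_eta nabla_xi_torsion)

lemma delta_Phi_torsion: "delta_form2 g (Phi g \<phi>) x (iota Y) = delta_Phi0 A Y"
  unfolding delta_form2_def delta_Phi0_def onb_trace[OF nabla_form2_bilinear]
  by (simp add: iota_e[symmetric] nabla_Phi_torsion)

section \<open>The Nijenhuis tensor\<close>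

lemma phi_field_frechet:
  assumes X: "X differentiable at x"
  shows "frechet_derivative (\<lambda>y. \<phi> y (X y)) (at x) u
    = frechet_derivative (\<lambda>y. \<phi> y (X x)) (at x) u + \<phi> x (frechet_derivative X (at x) u)"
proof -
  have expand: "(\<Sum>i\<in>UNIV. v $ i *\<^sub>R \<phi> y (e i)) = \<phi> y v" if "y \<in> U" for y v
  proof -
    have "\<phi> y v = \<phi> y (\<Sum>i\<in>UNIV. v $ i *\<^sub>R e i)"
      using basis_expansion[of v] by (simp add: e_def scalar_mult_eq_scaleR)
    then show ?thesis
      by (simp add: linear_sum[OF phi_lin[OF that]] linear_scale[OF phi_lin[OF that]])
  qed
  have phi': "((\<lambda>y. \<phi> y v) has_derivative frechet_derivative (\<lambda>y. \<phi> y v) (at x)) (at x)" for v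
    using phi_diff frechet_derivative_works by blast
  \<comment> \<open>Linearity of phi near \<open>x\<close> writes phi(Y) as the sum of the products
    of the scalars Y_i with the fields phi(e_i), to which the ordinary product rule applies.\<close>
  have D: "((\<lambda>y. \<phi> y (Y y)) has_derivative
      (\<lambda>u. \<Sum>i\<in>UNIV. Y x $ i *\<^sub>R frechet_derivative (\<lambda>y. \<phi> y (e i)) (at x) u
        + frechet_derivative Y (at x) u $ i *\<^sub>R \<phi> x (e i))) (at x)"
    if Y: "Y differentiable at x" for Y
  proof -
    have "((\<lambda>y. \<Sum>i\<in>UNIV. Y y $ i *\<^sub>R \<phi> y (e i)) has_derivative
      (\<lambda>u. \<Sum>i\<in>UNIV. Y x $ i *\<^sub>R frechet_derivative (\<lambda>y. \<phi> y (e i)) (at x) u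
        + frechet_derivative Y (at x) u $ i *\<^sub>R \<phi> x (e i))) (at x)"
      by (intro has_derivative_sum has_derivative_scaleR nth_has_derivative Y phi')
    then show ?thesis
      by (rule has_derivative_transform_within_open[OF _ open_U x_U]) (rule expand)
  qed
  show ?thesis
    \<comment> \<open>The same expansion for the constant field with value \<open>X x\<close>
      identifies the part in which only phi is differentiated.\<close>
    using frechet_derivative_eqI[OF D[OF X], of u] frechet_derivative_eqI[OF D[of "\<lambda>y. X x"], of u]
    by (simp add: sum.distrib expand[OF x_U])
qed

text \<open>Vanishing torsion allows the brackets to be written with the connection: the Christoffel
  terms without counterpart cancel by \<open>C_sym\<close>, and the derivatives of X and Y cancel
  altogether, so that only their values at \<open>x\<close> enter.\<close>

lemma nijenhuis_nabla:
  assumes X: "X differentiable at x" and Y: "Y differentiable at x"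
  shows "nijenhuis g \<xi> \<eta> \<phi> X Y x =
    nabla_endo g \<phi> x (\<phi> x (X x)) (Y x) - nabla_endo g \<phi> x (\<phi> x (Y x)) (X x)
    + \<phi> x (nabla_endo g \<phi> x (Y x) (X x)) - \<phi> x (nabla_endo g \<phi> x (X x) (Y x))
    + d_form1 g \<eta> x (X x) (Y x) *\<^sub>R \<xi> x"
  unfolding nijenhuis_def lie_bracket_def phi_field_frechet[OF X] phi_field_frechet[OF Y]
    nabla_endo_def nabla_const
  by (simp add: nabla_def phi_linear C_sym[of "\<phi> x (Y x)"] C_sym[of "Y x"])

lemma g_iota_phi: "g x (iota Z) (\<phi> x v) = - g x (iota (phi0 Z)) v"
proof -
  obtain X where "v = iota X" by (rule iota_surj)
  then show ?thesis by (simp add: phi_iota g_iota inner_phi0)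
qed

lemma torsion_normal:
  assumes "normal0 A" "X differentiable at x" "Y differentiable at x"
  shows "nijenhuis g \<xi> \<eta> \<phi> X Y x = 0"
proof (rule g_nondegenerate)
  fix w
  obtain Z X0 Y0 where w: "w = iota Z" and X: "X x = iota X0" and Y: "Y x = iota Y0"
    using iota_surj by metis
  have "g x w (nijenhuis g \<xi> \<eta> \<phi> X Y x)
    = nabla_Phi0 A (phi0 X0) Z Y0 - nabla_Phi0 A (phi0 Y0) Z X0
     - nabla_Phi0 A Y0 (phi0 Z) X0 + nabla_Phi0 A X0 (phi0 Z) Y0
     + (A X0 xi0 Y0 - A Y0 xi0 X0) * eta0 Z"
    unfolding nijenhuis_nabla[OF assms(2,3)] w X Y phi_iota g_linear g_iota_phi nabla_phi_torsion
      d_eta_torsion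
    by (simp add: xi_iota g_iota inner_xi0)
  then show "g x w (nijenhuis g \<xi> \<eta> \<phi> X Y x) = g x w 0"
    using assms(1) by (simp add: normal0_def g_linear)
qed

section \<open>The special types at the point, read off from the torsion\<close>

lemma torsion_d_Phi:
  assumes "closed_Phi0 A"
  shows "d_form2 g (Phi g \<phi>) x u v w = 0"
proof -
  obtain X Y Z where "u = iota X" "v = iota Y" "w = iota Z" using iota_surj by metis
  then show ?thesis using assms by (simp add: d_Phi_torsion closed_Phi0_def)
qed

lemma torsion_d_eta:
  assumes "closed_eta0 A"
  shows "d_form1 g \<eta> x u v = 0"
proof -
  obtain X Y where "u = iota X" "v = iota Y" using iota_surj by metis
  then show ?thesis using assms by (simp add: d_eta_torsion closed_eta0_def)
qed

lemma torsion_semi_cosymplectic: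
  assumes "semi_cosymplectic0 A"
  shows "delta_form2 g (Phi g \<phi>) x v = 0" "delta_form1 g \<eta> x = 0"
proof -
  obtain X where "v = iota X" using iota_surj by metis
  then show "delta_form2 g (Phi g \<phi>) x v = 0"
    using assms by (simp add: delta_Phi_torsion semi_cosymplectic0_def)
  show "delta_form1 g \<eta> x = 0"
    using assms by (simp add: delta_eta_torsion semi_cosymplectic0_def)
qed

lemma torsion_quasi_cosymplectic:
  assumes "quasi_cosymplectic0 A"
  shows "nabla_endo g \<phi> x u v + nabla_endo g \<phi> x (\<phi> x u) (\<phi> x v) = \<eta> x v *\<^sub>R nabla g \<xi> x (\<phi> x u)"
proof (rule g_nondegenerate)
  fix w
  obtain X Y Z where uvw: "u = iota X" "v = iota Y" "w = iota Z" using iota_surj by metis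
  have "g x (iota Z) (nabla g \<xi> x (iota X)) = A X xi0 Z" for X
    using nabla_xi_torsion[of X Z] g_sym[OF x_U] by simp
  then show "g x w (nabla_endo g \<phi> x u v + nabla_endo g \<phi> x (\<phi> x u) (\<phi> x v))
      = g x w (\<eta> x v *\<^sub>R nabla g \<xi> x (\<phi> x u))"
    using assms by (simp add: uvw phi_iota g_linear nabla_phi_torsion eta_iota
        quasi_cosymplectic0_def)
qed

lemma torsion_trans_Sasaki:
  assumes "trans_Sasaki0 A"
  shows "4 * nabla_form2 g (Phi g \<phi>) x u v w
    = g x u (delta_form2 g (Phi g \<phi>) x (\<xi> x) *\<^sub>R w + delta_form1 g \<eta> x *\<^sub>R \<phi> x w) * \<eta> x v
      - g x u (delta_form2 g (Phi g \<phi>) x (\<xi> x) *\<^sub>R v + delta_form1 g \<eta> x *\<^sub>R \<phi> x v) * \<eta> x w"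
proof -
  obtain X Y Z where uvw: "u = iota X" "v = iota Y" "w = iota Z" using iota_surj by metis
  show ?thesis
    unfolding uvw nabla_Phi_torsion phi_iota g_linear g_iota eta_iota xi_iota delta_Phi_torsion
      delta_eta_torsion real_scaleR_def
    using assms unfolding trans_Sasaki0_def by blast
qed

end

section \<open>From the point to the manifold\<close>

lemma almost_contact_frame_exists:
  assumes acm: "almost_contact_metric \<A> g \<xi> \<eta> \<phi>" and cls: "of_class \<A> g \<xi> \<phi> I"
    and c: "c \<in> \<A>" and x: "x \<in> chart_image c"
  obtains U E where "almost_contact_frame (g c) (\<xi> c) (\<eta> c) (\<phi> c) U E x"
    "intrinsic_torsion (g c) E x \<in> W_sum I"
proof -
  obtain U E where U: "open U" "x \<in> U" "U \<subseteq> chart_image c"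
    and E: "adapted_frame (g c) (\<xi> c) (\<phi> c) U E" and I: "intrinsic_torsion (g c) E x \<in> W_sum I"
    using cls c x unfolding of_class_def by blast
  have op: "open (chart_image c)"
    using acm c unfolding almost_contact_metric_def smooth_atlas_def by blast
  have g: "smooth_on (chart_image c) (\<lambda>x. g c x u v)"
    "y \<in> chart_image c \<Longrightarrow> bilinear (g c y)" "y \<in> chart_image c \<Longrightarrow> g c y u v = g c y v u"
    "y \<in> chart_image c \<Longrightarrow> u \<noteq> 0 \<Longrightarrow> g c y u u > 0" for u v y
    using acm c unfolding almost_contact_metric_def riemannian_metric_def by blast+
  have \<phi>: "smooth_on (chart_image c) (\<lambda>x. \<phi> c x v)" "y \<in> chart_image c \<Longrightarrow> linear (\<phi> c y)" for v y
    using acm c unfolding almost_contact_metric_def endomorphism_field_def by blast+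
  have \<eta>: "y \<in> chart_image c \<Longrightarrow> \<eta> c y v = g c y (\<xi> c y) v" for y v
    using acm c unfolding almost_contact_metric_def by blast
  have "almost_contact_frame (g c) (\<xi> c) (\<eta> c) (\<phi> c) U E x"
  proof (rule almost_contact_frame.intro)
    show "(\<lambda>y. g c y u v) differentiable at x" for u v
      by (rule smooth_on_differentiable[OF g(1) op x])
    show "(\<lambda>y. \<phi> c y v) differentiable at x" for v
      by (rule smooth_on_differentiable[OF \<phi>(1) op x])
    show "0 < g c x u u" if "u \<noteq> 0" for u
      by (rule g(4)[OF x that])
    show "bilinear (g c y)" if "y \<in> U" for y
      by (rule g(2)) (use U(3) that in blast)
    show "g c y u v = g c y v u" if "y \<in> U" for y u v
      by (rule g(3)) (use U(3) that in blast)
    show "linear (\<phi> c y)" if "y \<in> U" for y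
      by (rule \<phi>(2)) (use U(3) that in blast)
    show "\<eta> c y v = g c y (\<xi> c y) v" if "y \<in> U" for y v
      by (rule \<eta>) (use U(3) that in blast)
  qed (fact U E)+
  then show ?thesis using I by (rule that)
qed

theorem theorem3p4:
  fixes \<A> :: "'m::{t2_space,second_countable_topology} chart set"
    and g :: "'m chart \<Rightarrow> metric"
    and \<xi> :: "'m chart \<Rightarrow> vfield"
    and \<eta> :: "'m chart \<Rightarrow> field1"
    and \<phi> :: "'m chart \<Rightarrow> endo"
  assumes "almost_contact_metric \<A> g \<xi> \<eta> \<phi>"
  shows "(of_class \<A> g \<xi> \<phi> {1, 3, 5, 6, 8} \<longrightarrow> normal \<A> g \<xi> \<eta> \<phi>) \<and>
         (of_class \<A> g \<xi> \<phi> {9, 10} \<longrightarrow>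
            quasi_cosymplectic \<A> g \<xi> \<eta> \<phi> \<and> almost_cosymplectic \<A> g \<eta> \<phi>) \<and>
         (of_class \<A> g \<xi> \<phi> {4, 5, 7, 8, 9, 10} \<longrightarrow> semi_cosymplectic \<A> g \<eta> \<phi>) \<and>
         (of_class \<A> g \<xi> \<phi> {3, 5} \<longrightarrow> quasi_Sasaki \<A> g \<xi> \<eta> \<phi>) \<and>
         (of_class \<A> g \<xi> \<phi> {1, 3} \<longrightarrow> trans_Sasaki \<A> g \<xi> \<eta> \<phi>)"
proof -
  note frame = almost_contact_frame_exists[OF assms]
  \<comment> \<open>Stated for subsets of the index set, so that it also serves {3, 5} in the
    quasi-Sasaki case; likewise \<open>dPhi\<close> below serves both {9, 10} and {3, 5}.\<close>
  have normal: "normal \<A> g \<xi> \<eta> \<phi>" if cls: "of_class \<A> g \<xi> \<phi> I" and I: "I \<subseteq> {1, 3, 5, 6, 8}" for I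
    unfolding normal_def
  proof (intro ballI allI impI)
    fix c V x and X Y :: vfield
    assume c: "c \<in> \<A>" and x: "x \<in> V"
      and V: "open V \<and> V \<subseteq> chart_image c \<and> smooth_on V X \<and> smooth_on V Y"
    then have "x \<in> chart_image c" by blast
    \<comment> \<open>The domain V of the two fields and the neighbourhood U of the frame are
      unrelated; X and Y enter only through differentiability at x.\<close>
    from frame[OF cls c this] obtain U E
      where F: "almost_contact_frame (g c) (\<xi> c) (\<eta> c) (\<phi> c) U E x"
        and T: "intrinsic_torsion (g c) E x \<in> W_sum I" .
    show "nijenhuis (g c) (\<xi> c) (\<eta> c) (\<phi> c) X Y x = 0"
      using almost_contact_frame.torsion_normal[OF F W_sum_normal[OF T I]]
        smooth_on_differentiable V x by blast
  qed
  have dPhi: "dPhi_zero \<A> g \<phi>" if cls: "of_class \<A> g \<xi> \<phi> I" and I: "I \<subseteq> {3, 5, 9, 10}" for I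
    unfolding dPhi_zero_def
  proof (intro ballI allI)
    fix c x u v w assume c: "c \<in> \<A>" and x: "x \<in> chart_image c"
    show "d_form2 (g c) (Phi (g c) (\<phi> c)) x u v w = 0"
      by (rule frame[OF cls c x])
        (blast intro: almost_contact_frame.torsion_d_Phi W_sum_closed_Phi0[OF _ I])
  qed
  have "quasi_cosymplectic \<A> g \<xi> \<eta> \<phi>" if cls: "of_class \<A> g \<xi> \<phi> {9, 10}"
    unfolding quasi_cosymplectic_def
  proof (intro ballI allI)
    fix c x u v assume c: "c \<in> \<A>" and x: "x \<in> chart_image c"
    show "nabla_endo (g c) (\<phi> c) x u v + nabla_endo (g c) (\<phi> c) x (\<phi> c x u) (\<phi> c x v)
        = \<eta> c x v *\<^sub>R nabla (g c) (\<xi> c) x (\<phi> c x u)"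
      by (rule frame[OF cls c x], rule almost_contact_frame.torsion_quasi_cosymplectic, assumption)
        (rule W_sum_quasi_cosymplectic)
  qed
  moreover have "almost_cosymplectic \<A> g \<eta> \<phi>" if cls: "of_class \<A> g \<xi> \<phi> {9, 10}"
    unfolding almost_cosymplectic_def
  proof (intro conjI ballI allI)
    show "dPhi_zero \<A> g \<phi>" by (rule dPhi[OF cls]) simp
    fix c x u v assume c: "c \<in> \<A>" and x: "x \<in> chart_image c"
    show "d_form1 (g c) (\<eta> c) x u v = 0"
      by (rule frame[OF cls c x]) (blast intro: almost_contact_frame.torsion_d_eta W_sum_closed_eta0)
  qed
  moreover have "semi_cosymplectic \<A> g \<eta> \<phi>" if cls: "of_class \<A> g \<xi> \<phi> {4, 5, 7, 8, 9, 10}"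
    unfolding semi_cosymplectic_def
  proof (intro ballI)
    fix c x assume c: "c \<in> \<A>" and x: "x \<in> chart_image c"
    show "(\<forall>v. delta_form2 (g c) (Phi (g c) (\<phi> c)) x v = 0) \<and> delta_form1 (g c) (\<eta> c) x = 0"
      by (rule frame[OF cls c x])
        (blast intro: almost_contact_frame.torsion_semi_cosymplectic W_sum_semi_cosymplectic)
  qed
  moreover have "quasi_Sasaki \<A> g \<xi> \<eta> \<phi>" if cls: "of_class \<A> g \<xi> \<phi> {3, 5}"
    unfolding quasi_Sasaki_def using normal[OF cls] dPhi[OF cls] by simp
  moreover have "trans_Sasaki \<A> g \<xi> \<eta> \<phi>" if cls: "of_class \<A> g \<xi> \<phi> {1, 3}"
    unfolding trans_Sasaki_def Let_def
  proof (intro ballI allI)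
    fix c x u v w assume c: "c \<in> \<A>" and x: "x \<in> chart_image c"
    show "4 * nabla_form2 (g c) (Phi (g c) (\<phi> c)) x u v w
      = g c x u (delta_form2 (g c) (Phi (g c) (\<phi> c)) x (\<xi> c x) *\<^sub>R w
          + delta_form1 (g c) (\<eta> c) x *\<^sub>R \<phi> c x w) * \<eta> c x v
        - g c x u (delta_form2 (g c) (Phi (g c) (\<phi> c)) x (\<xi> c x) *\<^sub>R v
          + delta_form1 (g c) (\<eta> c) x *\<^sub>R \<phi> c x v) * \<eta> c x w"
      by (rule frame[OF cls c x], rule almost_contact_frame.torsion_trans_Sasaki, assumption)
        (rule W_sum_trans_Sasaki)
  qed
  ultimately show ?thesis using normal[OF _ subset_refl] by blast
qed

end
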